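(* Let $K:\mathbb S^{k}\times\mathbb S^{k}\to\mathbb R$ have the form $K(x,y)=g(d(x,y)^2)$ for all $x,y\in\mathbb S^k$, where $g:[0,\infty)\to\mathbb R$ is differentiable with locally Lipschitz continuous derivative. Let $\rho_0\in\mathcal P(\mathcal D_\varepsilon)$ and let $(\rho_0^n)_{n\in\mathbb N}\subset\mathcal P(\mathcal D_\varepsilon)$ be empirical measures, i.e. each $\rho_0^n$ is of the form $\rho_0^n=\sum_{i=1}^n m_i\delta_{x_i^0}$ with masses $m_i\in(0,1)$, $\sum_{i=1}^n m_i=1$, and points $x_i^0\in\mathcal D_\varepsilon$ (masses and points may depend on $n$), such that $W_1(\rho_0^n,\rho_0)\to0$ as $n\to\infty$. Suppose furthermore that $T>0$ is such that there exist a unique weak solution $\rho$ on $[0,T)$ to the aggregation model $\partial_t\rho-\nabla_{\mathbb S^k}\cdot(\rho\,\nabla_{\mathbb S^k}K*\rho)=0$ on $\mathcal D_\varepsilon$ starting from $\rho_0$, and, for all $n\in\mathbb N$, a unique weak solution $\rho^n$ on $[0,T)$ to the same model starting from $\rho_0^n$ (which is of the form $\rho^n_t=\sum_{i=1}^n m_i\delta_{x_i(t)}$, $t\in[0,T)$). Then there exists $T^*\in(0,T)$ such that $$\sup_{t\in[0,T^* )}W_1(\rho_t^n,\rho_t)\to0\qquad\text{as }n\to\infty.$$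
   Context: $\mathbb S^k\subset\mathbb R^{k+1}$ is the $k$-dimensional unit sphere with the metric induced from $\mathbb R^{k+1}$; its intrinsic distance is $d(x,y)=\arccos(x\cdot y)\in[0,\pi]$. Points and tangent vectors are regarded as vectors of $\mathbb R^{k+1}$. $N=(0,\dots,0,1)$ is the North pole. Fix $\varepsilon\in(0,\pi/2)$ and set $\mathcal D_\varepsilon=\{x\in\mathbb S^k: d(x,N)<\pi/2-\varepsilon\}$. $\mathcal P(\mathcal D_\varepsilon)$ is the set of Borel probability measures on $\mathcal D_\varepsilon$. $W_1(\rho,\sigma)=\inf_{\pi\in\Pi(\rho,\sigma)}\int d(x,y)\,d\pi(x,y)$ is the intrinsic 1-Wasserstein distance, $\Pi(\rho,\sigma)$ being the set of transport plans (couplings) between $\rho$ and $\sigma$. For a curve $(\rho_t)_{t\in[0,T)}\subset\mathcal P(\mathcal D_\varepsilon)$ the velocity field is $v[\rho](x,t)=-\int_{\mathcal D_\varepsilon}\nabla_{\mathbb S^k}K_y(x)\,d\rho_t(y)$, where $K_y(x)=K(x,y)$ and $\nabla_{\mathbb S^k}$ is the manifold gradient in $x$; for $x,y\in\mathcal D_\varepsilon$, $\nabla_{\mathbb S^k}K_y(x)=-2g'(d(x,y)^2)\log_xy$, with $\log_x y=\frac{\theta}{\sin\theta}(y-\cos\theta\,x)$, $\theta=d(x,y)$ (and $\log_xx=0$). Given a time-dependent vector field $X$ on $\mathcal D_\varepsilon$ and $\Sigma\subset\mathcal D_\varepsilon$, a flow map generated by $(X,\Sigma)$ on $[0,T)$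 is a map $\Psi_X:\Sigma\times[0,T)\to\mathcal D_\varepsilon$, written $\Psi_X^t(x)$, with $\frac{d}{dt}\Psi_X^t(x)=X(\Psi_X^t(x),t)$ and $\Psi_X^0(x)=x$ for all $x\in\Sigma$, $t\in[0,T)$. A curve $(\rho_t)_{t\in[0,T)}\subset\mathcal P(\mathcal D_\varepsilon)$ is a weak solution (starting from $\rho_0$) if $v[\rho]$ generates a unique flow map $\Psi_{v[\rho]}$ defined on $\operatorname{supp}(\rho_0)\times[0,T)$ and $\rho_t=\Psi^t_{v[\rho]}\#\rho_0$ (push-forward) for all $t\in[0,T)$. *)

theory Defs
  imports "HOL-Probability.Probability"
begin

text \<open>
  The unit sphere of a Euclidean space is the library's \<open>sphere 0 1\<close>.  The Euclidean space of
  dimension \<open>k + 1\<close> is rendered as \<open>(real ^ 'k) \<times> real\<close> with \<open>k = CARD('k) \<ge> 1\<close>, so that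
  the last coordinate is the second component of the pair.
\<close>

definition sphere_dist :: "'a::real_inner \<Rightarrow> 'a \<Rightarrow> real" where
  "sphere_dist x y = arccos (x \<bullet> y)"

definition north_pole :: "(real ^ 'k) \<times> real" where
  "north_pole = (0, 1)"

definition cap :: "real \<Rightarrow> ((real ^ 'k) \<times> real) set" where
  "cap \<epsilon> = {x \<in> sphere 0 1. sphere_dist x north_pole < pi / 2 - \<epsilon>}"

text \<open>
  The manifold gradient at a point \<open>x\<close> of the sphere: the tangent vector representing, through
  the metric induced from the ambient space, the differential at \<open>x\<close> of a function on the sphere.
  As the sphere is an embedded submanifold, differentiability on it is differentiability within it,
  so only the values of \<open>f\<close> on the sphere matter.  The derivative within the sphere is determined
  on tangent vectors only; requiring \<open>v\<close> to be tangent makes \<open>v\<close> unique.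
\<close>

definition sphere_grad :: "('a::euclidean_space \<Rightarrow> real) \<Rightarrow> 'a \<Rightarrow> 'a" where
  "sphere_grad f x =
    (THE v. v \<bullet> x = 0 \<and> (f has_derivative (\<lambda>h. v \<bullet> h)) (at x within sphere 0 1))"

definition locally_lipschitz_on :: "real set \<Rightarrow> (real \<Rightarrow> real) \<Rightarrow> bool" where
  "locally_lipschitz_on S f \<longleftrightarrow>
    (\<forall>s\<in>S. \<exists>u>0. \<exists>L. L-lipschitz_on (cball s u \<inter> S) f)"

definition prob_measures :: "'a::topological_space set \<Rightarrow> 'a measure set" where
  "prob_measures D = {\<mu>. prob_space \<mu> \<and> sets \<mu> = sets (restrict_space borel D)}"

text \<open>The support, as a subset of \<open>space \<mu>\<close> with its subspace topology.\<close>

definition supp :: "'a::topological_space measure \<Rightarrow> 'a set" where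
  "supp \<mu> = {x \<in> space \<mu>. \<forall>U. open U \<longrightarrow> x \<in> U \<longrightarrow> emeasure \<mu> (U \<inter> space \<mu>) > 0}"

definition transport_plans :: "'a measure \<Rightarrow> 'a measure \<Rightarrow> ('a \<times> 'a) measure set" where
  "transport_plans \<rho> \<sigma> =
    {\<gamma>. prob_space \<gamma> \<and> sets \<gamma> = sets (\<rho> \<Otimes>\<^sub>M \<sigma>) \<and> distr \<gamma> \<rho> fst = \<rho> \<and> distr \<gamma> \<sigma> snd = \<sigma>}"

definition W1 :: "'a::real_inner measure \<Rightarrow> 'a measure \<Rightarrow> ennreal" where
  "W1 \<rho> \<sigma> =
    (INF \<gamma>\<in>transport_plans \<rho> \<sigma>. \<integral>\<^sup>+p. ennreal (sphere_dist (fst p) (snd p)) \<partial>\<gamma>)"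

definition velocity ::
  "('a::euclidean_space \<Rightarrow> 'a \<Rightarrow> real) \<Rightarrow> (real \<Rightarrow> 'a measure) \<Rightarrow> 'a \<Rightarrow> real \<Rightarrow> 'a" where
  "velocity K \<rho> x t = - (\<integral>y. sphere_grad (\<lambda>z. K z y) x \<partial>\<rho> t)"

text \<open>
  Flow maps on \<open>[0, T)\<close> with values in \<open>D\<close>; \<open>\<Psi> t x\<close> is the position at time \<open>t\<close> of the
  trajectory from \<open>x\<close>.  At time \<open>0\<close> the derivative is the one-sided one.
\<close>

definition flow_map ::
  "'a::real_normed_vector set \<Rightarrow> ('a \<Rightarrow> real \<Rightarrow> 'a) \<Rightarrow> 'a set \<Rightarrow> real \<Rightarrow> (real \<Rightarrow> 'a \<Rightarrow> 'a) \<Rightarrow> bool"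
where
  "flow_map D X \<Sigma> T \<Psi> \<longleftrightarrow>
    (\<forall>x\<in>\<Sigma>. \<Psi> 0 x = x \<and>
      (\<forall>t\<in>{0..<T}. \<Psi> t x \<in> D \<and>
        ((\<lambda>s. \<Psi> s x) has_vector_derivative X (\<Psi> t x) t) (at t within {0..<T})))"

definition unique_flow_map ::
  "'a::real_normed_vector set \<Rightarrow> ('a \<Rightarrow> real \<Rightarrow> 'a) \<Rightarrow> 'a set \<Rightarrow> real \<Rightarrow> (real \<Rightarrow> 'a \<Rightarrow> 'a) \<Rightarrow> bool"
where
  "unique_flow_map D X \<Sigma> T \<Psi> \<longleftrightarrow>
    flow_map D X \<Sigma> T \<Psi> \<and>
    (\<forall>\<Phi>. flow_map D X \<Sigma> T \<Phi> \<longrightarrow> (\<forall>x\<in>\<Sigma>. \<forall>t\<in>{0..<T}. \<Phi> t x = \<Psi> t x))"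

text \<open>
  Push-forward by a map that is meaningful only on the support of \<open>\<mu>\<close>.  Measurability is
  demanded because \<open>distr\<close> is a push-forward only for measurable maps.
\<close>

definition is_push_forward ::
  "'a::topological_space set \<Rightarrow> ('a \<Rightarrow> 'a) \<Rightarrow> 'a measure \<Rightarrow> 'a measure \<Rightarrow> bool" where
  "is_push_forward D f \<mu> \<nu> \<longleftrightarrow>
    f \<in> restrict_space \<mu> (supp \<mu>) \<rightarrow>\<^sub>M restrict_space borel D \<and>
    \<nu> = distr (restrict_space \<mu> (supp \<mu>)) (restrict_space borel D) f"

text \<open>
  Curves of measures are total functions of time, of which only the values on \<open>[0, T)\<close> matter;
  uniqueness is accordingly uniqueness on \<open>[0, T)\<close>.
\<close>

definition weak_solution ::
  "'a::euclidean_space set \<Rightarrow> ('a \<Rightarrow> 'a \<Rightarrow> real) \<Rightarrow> real \<Rightarrow> 'a measure \<Rightarrow>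
    (real \<Rightarrow> 'a measure) \<Rightarrow> bool" where
  "weak_solution D K T \<rho>0 \<rho> \<longleftrightarrow>
    (\<forall>t\<in>{0..<T}. \<rho> t \<in> prob_measures D) \<and>
    (\<exists>\<Psi>. unique_flow_map D (velocity K \<rho>) (supp \<rho>0) T \<Psi> \<and>
      (\<forall>t\<in>{0..<T}. is_push_forward D (\<Psi> t) \<rho>0 (\<rho> t)))"

definition unique_weak_solution ::
  "'a::euclidean_space set \<Rightarrow> ('a \<Rightarrow> 'a \<Rightarrow> real) \<Rightarrow> real \<Rightarrow> 'a measure \<Rightarrow>
    (real \<Rightarrow> 'a measure) \<Rightarrow> bool" where
  "unique_weak_solution D K T \<rho>0 \<rho> \<longleftrightarrow>
    weak_solution D K T \<rho>0 \<rho> \<and>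
    (\<forall>\<sigma>. weak_solution D K T \<rho>0 \<sigma> \<longrightarrow> (\<forall>t\<in>{0..<T}. \<sigma> t = \<rho> t))"

text \<open>
  \<open>return M x\<close> is the Dirac measure at \<open>x\<close>.  Masses in the open unit interval
  summing to one exist for \<open>n \<ge> 2\<close> only.
\<close>

definition empirical_measure :: "'a::topological_space set \<Rightarrow> nat \<Rightarrow> 'a measure \<Rightarrow> bool" where
  "empirical_measure D n \<mu> \<longleftrightarrow>
    \<mu> \<in> prob_measures D \<and>
    (\<exists>m x. (\<forall>i\<in>{1..n}. 0 < m i \<and> m i < (1::real) \<and> x i \<in> D) \<and> (\<Sum>i=1..n. m i) = 1 \<and>
      (\<forall>A\<in>sets \<mu>. emeasure \<mu> A =
        (\<Sum>i=1..n. ennreal (m i) * emeasure (return (restrict_space borel D) (x i)) A)))"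

end

theory Submission
  imports Defs
begin

text \<open>
  The interaction gradient \<open>F x y\<close>, the gradient at \<open>x\<close> of \<open>K\<close> with second argument \<open>y\<close>, is
  Lipschitz in \<open>(x, y)\<close> on the cap, and this forces stability of the flow in \<open>W1\<close> by Dobrushin's coupling
  argument.
  
  Couple the initial measures \<open>\<mu>\<close> and \<open>\<nu>\<close> by a plan \<open>\<gamma>\<close> and move both coordinates of \<open>\<gamma>\<close> along the
  flows \<open>\<Phi>\<close>, \<open>\<Psi>\<close> of the two solutions.  This gives a coupling of the solutions at time \<open>t\<close>, with
  Euclidean cost \<open>e t = \<integral> |\<Phi> t x - \<Psi> t y| d\<gamma>\<close>.  Up to sign both velocities are averages of \<open>F\<close> over \<open>\<gamma>\<close>, so the
  velocities of a pair \<open>(x, y)\<close> differ by at most \<open>L (|\<Phi> t x - \<Psi> t y| + e t)\<close>.  Averaging over \<open>\<gamma>\<close>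
  and applying Gronwall's inequality yields \<open>e t \<le> exp (2 L t) e 0\<close>
  (\<open>self_consistent_flow_stability\<close>).  On the cap the intrinsic and the Euclidean distance are
  equivalent, and the infimum over \<open>\<gamma>\<close> shows that \<open>W1\<close> grows by at most a constant factor on
  \<open>[0, T)\<close> (\<open>W1_self_consistent_flow_le\<close>).  The constant depends only on the cap, \<open>g'\<close> and \<open>T\<close>, hence
  not on \<open>n\<close>; any time before \<open>T\<close> serves as \<open>T'\<close>.
  
  The Gronwall step compares \<open>e\<close> at two times \<open>s \<le> r\<close> up to an error of order \<open>(r - s)\<^sup>2\<close> instead of
  differentiating \<open>e\<close> or exchanging integrals over \<open>\<gamma>\<close> and over time.  Measurability of the flows
  at each fixed time, which the push-forward provides, is then enough.
  
  The Lipschitz bound for \<open>F\<close> rests on the explicit gradient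
  \<open>F x y = - 2 g' (\<theta>\<^sup>2) (\<theta> / sin \<theta>) (y - cos \<theta> x)\<close> with \<open>cos \<theta> = x \<bullet> y\<close> (\<open>sphere_grad_kernel\<close>).  On the
  cap \<open>\<theta>\<close> stays away from \<open>\<pi>\<close>, and there \<open>\<theta>\<^sup>2\<close> and \<open>\<theta> / sin \<theta>\<close> are Lipschitz functions of \<open>cos \<theta>\<close>
  although \<open>\<theta>\<close> itself is not (\<open>lipschitz_on_kernel_grad\<close>).
\<close>

section \<open>Functions of the angle as functions of its cosine\<close>

lemma sin_ge_linear:
  assumes "0 \<le> a" and "a < pi"
  obtains m where "0 < m" and "\<And>\<theta>. 0 \<le> \<theta> \<Longrightarrow> \<theta> \<le> a \<Longrightarrow> m * \<theta> \<le> sin \<theta>"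
proof -
  have "continuous_on {0..a} (\<lambda>\<theta>. sinc \<theta>)"
    by (rule continuous_on_sinc) (rule continuous_on_id)
  moreover have "{0..a} \<noteq> {}" using assms by auto
  ultimately obtain \<theta>0 where \<theta>0: "\<theta>0 \<in> {0..a}" "\<And>\<theta>. \<theta> \<in> {0..a} \<Longrightarrow> sinc \<theta>0 \<le> sinc \<theta>"
    using continuous_attains_inf[OF compact_Icc, of 0 a sinc] by blast
  have "0 < sinc \<theta>0"
    using \<theta>0(1) assms by (auto intro!: divide_pos_pos sin_gt_zero)
  moreover have "sinc \<theta>0 * \<theta> \<le> sin \<theta>" if "0 \<le> \<theta>" "\<theta> \<le> a" for \<theta>
  proof (cases "\<theta> = 0")
    case False
    then have "sinc \<theta>0 \<le> sin \<theta> / \<theta>" using \<theta>0(2)[of \<theta>] that by auto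
    then show ?thesis using False that by (simp add: pos_le_divide_eq)
  qed simp
  ultimately show ?thesis using that by blast
qed

text \<open>
  The angle is not a Lipschitz function of its cosine at \<open>0\<close>, but a function of the angle whose
  derivative vanishes at \<open>0\<close> at least like \<open>sin\<close> is: comparing it with \<open>- B * cos\<close> turns the
  derivative bound into monotonicity.
\<close>

lemma lipschitz_on_comp_arccos:
  fixes f f' :: "real \<Rightarrow> real"
  assumes a: "0 \<le> a" "a \<le> pi" and "0 \<le> B"
    and cont: "continuous_on {0..a} f"
    and deriv: "\<And>\<theta>. 0 < \<theta> \<Longrightarrow> \<theta> < a \<Longrightarrow> (f has_real_derivative f' \<theta>) (at \<theta>)"
    and bound: "\<And>\<theta>. 0 < \<theta> \<Longrightarrow> \<theta> < a \<Longrightarrow> \<bar>f' \<theta>\<bar> \<le> B * sin \<theta>"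
  shows "B-lipschitz_on {cos a..1} (\<lambda>c. f (arccos c))"
proof (rule lipschitz_on_leI)
  fix c d :: real
  assume c: "c \<in> {cos a..1}" and d: "d \<in> {cos a..1}" and "c \<le> d"
  have ca: "-1 \<le> c" "-1 \<le> d"
    using c d cos_ge_minus_one[of a] by (auto simp del: cos_ge_minus_one)
  have *: "arccos d \<le> arccos c"
    using \<open>c \<le> d\<close> c d ca by (intro arccos_le_arccos) auto
  have "arccos c \<le> arccos (cos a)"
    using c ca by (intro arccos_le_arccos) auto
  then have **: "arccos c \<le> a" using a by (simp add: arccos_cos)
  have d0: "0 \<le> arccos d" using d ca by (intro arccos_lbound) auto
  have sub: "{arccos d..arccos c} \<subseteq> {0..a}" using ** d0 by auto
  \<comment> \<open>The two signs \<open>s\<close> give the two sides of the bound on the absolute value.\<close>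
  have mono: "- B * cos (arccos d) + s * f (arccos d) \<le> - B * cos (arccos c) + s * f (arccos c)"
    if s: "s = 1 \<or> s = -1" for s :: real
  proof (rule DERIV_nonneg_imp_increasing_open[OF *])
    fix \<theta> assume \<theta>: "arccos d < \<theta>" "\<theta> < arccos c"
    have "((\<lambda>\<theta>. - B * cos \<theta> + s * f \<theta>) has_real_derivative B * sin \<theta> + s * f' \<theta>) (at \<theta>)"
      using \<theta> ** d0 by (auto intro!: derivative_eq_intros deriv)
    moreover have "0 \<le> B * sin \<theta> + s * f' \<theta>"
      using bound[of \<theta>] \<theta> ** d0 s by auto
    ultimately show "\<exists>y. ((\<lambda>\<theta>. - B * cos \<theta> + s * f \<theta>) has_real_derivative y) (at \<theta>) \<and> 0 \<le> y"
      by blast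
  next
    show "continuous_on {arccos d..arccos c} (\<lambda>\<theta>. - B * cos \<theta> + s * f \<theta>)"
      using continuous_on_subset[OF cont sub] by (intro continuous_intros)
  qed
  have "cos (arccos c) = c" "cos (arccos d) = d" using c d ca by (auto intro!: cos_arccos)
  then have "- B * d + s * f (arccos d) \<le> - B * c + s * f (arccos c)" if "s = 1 \<or> s = -1" for s
    using mono[OF that] by simp
  from this[of 1] this[of "-1"]
  have "\<bar>f (arccos c) - f (arccos d)\<bar> \<le> B * (d - c)" by (simp add: algebra_simps)
  then show "dist (f (arccos c)) (f (arccos d)) \<le> B * dist c d"
    using \<open>c \<le> d\<close> by (simp add: dist_real_def)
qed fact

lemma lipschitz_on_arccos_sq:
  assumes "-1 < c0" and "c0 \<le> 1"
  obtains L where "L-lipschitz_on {c0..1} (\<lambda>c. (arccos c)\<^sup>2)"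
proof -
  define a where "a = arccos c0"
  have a: "0 \<le> a" "a < pi" "cos a = c0"
    using assms arccos_less_mono[of c0 "-1"] by (auto simp: a_def arccos_lbound)
  obtain m where m: "0 < m" "\<And>\<theta>. 0 \<le> \<theta> \<Longrightarrow> \<theta> \<le> a \<Longrightarrow> m * \<theta> \<le> sin \<theta>"
    using sin_ge_linear[OF a(1,2)] by blast
  have "(2 / m)-lipschitz_on {cos a..1} (\<lambda>c. (\<lambda>\<theta>. \<theta>\<^sup>2) (arccos c))"
  proof (rule lipschitz_on_comp_arccos[where f' = "\<lambda>\<theta>. 2 * \<theta>"])
    fix \<theta> assume "0 < \<theta>" "\<theta> < a"
    then show "\<bar>2 * \<theta>\<bar> \<le> 2 / m * sin \<theta>"
      using m(2)[of \<theta>] m(1) by (simp add: field_simps)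
  qed (use a m(1) in \<open>auto intro!: continuous_intros derivative_eq_intros\<close>)
  then show ?thesis using that a by simp
qed

text \<open>
  The numerator of the derivative of \<open>\<theta> / sin \<theta>\<close>.  Its own derivative \<open>\<theta> * sin \<theta>\<close> is at most
  \<open>\<theta>\<^sup>2\<close>, which gives the third order needed against the denominator.
\<close>

lemma abs_sin_minus_mult_cos_le:
  fixes \<theta> :: real
  assumes "0 \<le> \<theta>"
  shows "\<bar>sin \<theta> - \<theta> * cos \<theta>\<bar> \<le> \<theta> ^ 3"
proof -
  have "0 ^ 3 - s * (sin 0 - 0 * cos 0) \<le> \<theta> ^ 3 - s * (sin \<theta> - \<theta> * cos \<theta>)"
    if s: "s = 1 \<or> s = -1" for s :: real
  proof (rule DERIV_nonneg_imp_nondecreasing[OF assms])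
    fix x :: real assume x: "0 \<le> x"
    have "((\<lambda>\<theta>. \<theta> ^ 3 - s * (sin \<theta> - \<theta> * cos \<theta>)) has_real_derivative 3 * x\<^sup>2 - s * (x * sin x)) (at x)"
      by (auto intro!: derivative_eq_intros simp: power2_eq_square algebra_simps)
    moreover have "\<bar>x * sin x\<bar> \<le> x * x"
      using x abs_sin_x_le_abs_x[of x] by (simp add: abs_mult mult_left_mono)
    then have "0 \<le> 3 * x\<^sup>2 - s * (x * sin x)" using s x unfolding power2_eq_square by auto
    ultimately show "\<exists>y. ((\<lambda>\<theta>. \<theta> ^ 3 - s * (sin \<theta> - \<theta> * cos \<theta>)) has_real_derivative y) (at x) \<and> 0 \<le> y"
      by blast
  qed
  from this[of 1] this[of "-1"] show ?thesis by simp
qed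

lemma lipschitz_on_inverse_sinc_arccos:
  assumes "-1 < c0" and "c0 \<le> 1"
  obtains L where "L-lipschitz_on {c0..1} (\<lambda>c. inverse (sinc (arccos c)))"
proof -
  define a where "a = arccos c0"
  have a: "0 \<le> a" "a < pi" "cos a = c0"
    using assms arccos_less_mono[of c0 "-1"] by (auto simp: a_def arccos_lbound)
  obtain m where m: "0 < m" "\<And>\<theta>. 0 \<le> \<theta> \<Longrightarrow> \<theta> \<le> a \<Longrightarrow> m * \<theta> \<le> sin \<theta>"
    using sin_ge_linear[OF a(1,2)] by blast
  have "(1 / m ^ 3)-lipschitz_on {cos a..1} (\<lambda>c. (\<lambda>\<theta>. inverse (sinc \<theta>)) (arccos c))"
  proof (rule lipschitz_on_comp_arccos[where f' = "\<lambda>\<theta>. (sin \<theta> - \<theta> * cos \<theta>) / (sin \<theta>)\<^sup>2"])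
    show "continuous_on {0..a} (\<lambda>\<theta>. inverse (sinc \<theta>))"
    proof (intro continuous_on_inverse continuous_on_sinc continuous_on_id ballI)
      fix \<theta> assume "\<theta> \<in> {0..a}"
      then show "sinc \<theta> \<noteq> 0" using a sin_gt_zero[of \<theta>] by (cases "\<theta> = 0") auto
    qed
  next
    fix \<theta> assume \<theta>: "0 < \<theta>" "\<theta> < a"
    then have s: "0 < sin \<theta>" using a sin_gt_zero[of \<theta>] by auto
    have "((\<lambda>\<theta>. \<theta> / sin \<theta>) has_real_derivative (sin \<theta> - \<theta> * cos \<theta>) / (sin \<theta>)\<^sup>2) (at \<theta>)"
      using s by (auto intro!: derivative_eq_intros simp: power2_eq_square)
    then show "((\<lambda>\<theta>. inverse (sinc \<theta>)) has_real_derivative (sin \<theta> - \<theta> * cos \<theta>) / (sin \<theta>)\<^sup>2) (at \<theta>)"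
      by (rule has_field_derivative_transform_within_open[where S = "{0<..<a}"]) (use \<theta> in auto)
    have "(m * \<theta>) ^ 3 \<le> sin \<theta> ^ 3"
      using m(2)[of \<theta>] m(1) \<theta> by (intro power_mono) auto
    then have "\<theta> ^ 3 \<le> 1 / m ^ 3 * sin \<theta> ^ 3" using m(1) by (simp add: field_simps)
    then have "\<bar>sin \<theta> - \<theta> * cos \<theta>\<bar> \<le> 1 / m ^ 3 * sin \<theta> ^ 3"
      using abs_sin_minus_mult_cos_le[of \<theta>] \<theta> by linarith
    then show "\<bar>(sin \<theta> - \<theta> * cos \<theta>) / (sin \<theta>)\<^sup>2\<bar> \<le> 1 / m ^ 3 * sin \<theta>"
      using s by (simp add: abs_divide pos_divide_le_eq power3_eq_cube power2_eq_square mult.assoc)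
  qed (use a m(1) in auto)
  then show ?thesis using that a by simp
qed

text \<open>
  The square removes the square root singularity of \<open>arccos\<close> at \<open>1\<close>: with \<open>y = cos (2 * h)\<close> the
  difference quotient there is \<open>(2 * h)\<^sup>2 / (- 2 * (sin h)\<^sup>2)\<close>.  So the kernel has a gradient at
  coinciding points as well.
\<close>

lemma has_real_derivative_arccos_sq:
  assumes "-1 < c" and "c \<le> 1"
  shows "((\<lambda>c. (arccos c)\<^sup>2) has_real_derivative - 2 * inverse (sinc (arccos c))) (at c within {-1..1})"
proof (cases "c = 1")
  case False
  then have c: "-1 < c" "c < 1" using assms by auto
  have "arccos c \<noteq> 0" using c by (metis cos_arccos cos_zero less_eq_real_def less_irrefl)
  moreover have "sin (arccos c) = sqrt (1 - c\<^sup>2)" using c by (intro sin_arccos) auto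
  ultimately have "((\<lambda>c. (arccos c)\<^sup>2) has_real_derivative - 2 * inverse (sinc (arccos c))) (at c)"
    using c by (auto intro!: derivative_eq_intros simp: field_simps)
  then show ?thesis by (rule DERIV_subset) simp
next
  case True
  have "((\<lambda>y. -2 * (inverse (sinc (arccos y / 2)))\<^sup>2) \<longlongrightarrow> -2 * (inverse 1)\<^sup>2) (at 1 within {-1..1})"
  proof (intro tendsto_intros)
    have "continuous_on {-1..1::real} (\<lambda>y. sinc (arccos y / 2))"
      by (intro continuous_on_sinc continuous_intros) auto
    from this[unfolded continuous_on_def, rule_format, of 1]
    show "((\<lambda>y. sinc (arccos y / 2)) \<longlongrightarrow> 1) (at 1 within {-1..1})" by simp
  qed auto
  moreover have "-2 * (inverse (sinc (arccos y / 2)))\<^sup>2 = ((arccos y)\<^sup>2 - (arccos 1)\<^sup>2) / (y - 1)"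
    if "-1 \<le> y" "y < 1" for y :: real
  proof -
    define h where "h = arccos y / 2"
    have y: "y = cos (2 * h)" using that by (simp add: h_def)
    then have y1: "y - 1 = - 2 * (sin h)\<^sup>2" by (simp only: cos_double_sin)
    have h: "h \<noteq> 0" using y that by auto
    have "arccos y = 2 * h" by (simp add: h_def)
    then show ?thesis
      using h unfolding y1 by (simp add: power_divide power_mult_distrib power_inverse)
  qed
  then have "\<forall>\<^sub>F y in at 1 within {-1..1}.
      -2 * (inverse (sinc (arccos y / 2)))\<^sup>2 = ((arccos y)\<^sup>2 - (arccos 1)\<^sup>2) / (y - 1)"
    unfolding eventually_at by (intro exI[of _ 1]) auto
  ultimately have "((\<lambda>y. ((arccos y)\<^sup>2 - (arccos 1)\<^sup>2) / (y - 1)) \<longlongrightarrow> -2) (at 1 within {-1..1})"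
    by (simp add: tendsto_cong)
  then show ?thesis using True by (simp add: has_field_derivative_iff)
qed

section \<open>Gradients on the sphere\<close>

text \<open>
  Unit vectors satisfy \<open>x \<bullet> z = 1 - |z - x|\<^sup>2 / 2\<close>, which is flat to first order at \<open>x\<close>.  Hence
  normal components of a gradient do not matter for derivatives within the sphere.
\<close>

lemma has_derivative_inner_within_sphere:
  fixes x :: "'a::real_inner"
  assumes "norm x = 1"
  shows "((\<lambda>z. x \<bullet> z) has_derivative (\<lambda>h. 0)) (at x within sphere 0 1)"
proof -
  have "((\<lambda>z. 1 - (z - x) \<bullet> (z - x) / 2) has_derivative (\<lambda>h. 0)) (at x within sphere 0 1)"
    by (auto intro!: derivative_eq_intros)
  then show ?thesis
  proof (rule has_derivative_transform[rotated 2])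
    fix z assume "z \<in> sphere (0::'a) 1"
    then have "z \<bullet> z = 1" "x \<bullet> x = 1" using assms by (auto simp: dot_square_norm)
    then show "x \<bullet> z = 1 - (z - x) \<bullet> (z - x) / 2"
      by (simp add: inner_diff_left inner_diff_right inner_commute field_simps)
  qed (use assms in auto)
qed

text \<open>
  Differentiating along the great circle through \<open>x\<close> in direction \<open>u\<close> yields \<open>norm u = 0\<close>.  This is
  the uniqueness behind the definite description in \<open>sphere_grad\<close>.
\<close>

lemma tangent_zero_if_zero_derivative_within_sphere:
  fixes x u :: "'a::real_inner"
  assumes "norm x = 1" and "u \<bullet> x = 0"
    and deriv: "((\<lambda>z. 0::real) has_derivative (\<lambda>h. u \<bullet> h)) (at x within sphere 0 1)"
  shows "u = 0"
proof (rule ccontr)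
  assume "u \<noteq> 0"
  define w where "w = u /\<^sub>R norm u"
  have w: "norm w = 1" "w \<bullet> x = 0" "u \<bullet> w = norm u"
    using \<open>u \<noteq> 0\<close> assms(2) by (simp_all add: w_def dot_square_norm power2_eq_square)
  define c where "c = (\<lambda>t::real. cos t *\<^sub>R x + sin t *\<^sub>R w)"
  have "(c has_derivative (\<lambda>s. s *\<^sub>R w)) (at 0)"
    unfolding c_def by (auto intro!: derivative_eq_intros)
  moreover have "range c \<subseteq> sphere 0 1"
  proof safe
    fix t
    have "c t \<bullet> c t = (cos t)\<^sup>2 + (sin t)\<^sup>2"
      using w assms(1) unfolding c_def
      by (simp add: inner_add_left inner_add_right inner_commute[of x w] dot_square_norm[of x] dot_square_norm[of w]
          power2_eq_square[symmetric])
    then show "c t \<in> sphere 0 1" by (simp add: norm_eq_1)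
  qed
  then have "((\<lambda>z. 0::real) has_derivative (\<lambda>h. u \<bullet> h)) (at (c 0) within range c)"
    using has_derivative_subset[OF deriv] by (simp add: c_def)
  ultimately have "((\<lambda>t. 0::real) has_derivative (\<lambda>s. u \<bullet> (s *\<^sub>R w))) (at 0)"
    by (rule has_derivative_in_compose)
  then have "((\<lambda>t. 0::real) has_real_derivative norm u) (at 0)"
    by (simp add: has_field_derivative_def w(3) mult.commute[of _ "norm u"])
  then have "norm u = 0" by (rule DERIV_unique) simp
  then show False using \<open>u \<noteq> 0\<close> by simp
qed

lemma sphere_grad_eqI:
  fixes x :: "'a::euclidean_space"
  assumes "norm x = 1" and "v \<bullet> x = 0"
    and deriv: "(f has_derivative (\<lambda>h. v \<bullet> h)) (at x within sphere 0 1)"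
  shows "sphere_grad f x = v"
  unfolding sphere_grad_def
proof (rule the_equality)
  fix w assume w: "w \<bullet> x = 0 \<and> (f has_derivative (\<lambda>h. w \<bullet> h)) (at x within sphere 0 1)"
  have "((\<lambda>z. f z - f z) has_derivative (\<lambda>h. w \<bullet> h - v \<bullet> h)) (at x within sphere 0 1)"
    using w deriv by (intro has_derivative_diff) auto
  then have "((\<lambda>z. 0) has_derivative (\<lambda>h. (w - v) \<bullet> h)) (at x within sphere 0 1)"
    by (simp add: inner_diff_left)
  then have "w - v = 0"
    using w assms by (intro tangent_zero_if_zero_derivative_within_sphere[OF assms(1)])
      (simp_all add: inner_diff_left)
  then show "w = v" by simp
qed (use assms in simp)

text \<open>
  The ambient gradient of \<open>z \<mapsto> \<phi> (z \<bullet> y)\<close> is \<open>r *\<^sub>R y\<close>; the gradient on the sphere is its tangential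
  part.
\<close>

lemma sphere_grad_zonal:
  fixes x y :: "'a::euclidean_space"
  assumes "norm x = 1" and "norm y = 1"
    and f: "\<And>z. norm z = 1 \<Longrightarrow> f z = \<phi> (z \<bullet> y)"
    and \<phi>: "(\<phi> has_real_derivative r) (at (x \<bullet> y) within {-1..1})"
  shows "sphere_grad f x = r *\<^sub>R (y - (x \<bullet> y) *\<^sub>R x)"
proof (rule sphere_grad_eqI[OF \<open>norm x = 1\<close>])
  show "(r *\<^sub>R (y - (x \<bullet> y) *\<^sub>R x)) \<bullet> x = 0"
    using assms(1) by (simp add: inner_diff_left inner_commute[of y x] dot_square_norm)
  have "(\<lambda>z. z \<bullet> y) ` sphere 0 1 \<subseteq> {-1..1}"
  proof safe
    fix z :: 'a assume "z \<in> sphere 0 1"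
    then show "z \<bullet> y \<in> {-1..1}"
      using Cauchy_Schwarz_ineq2[of z y] assms(2) by (auto simp: abs_le_iff)
  qed
  with \<phi> have "(\<phi> has_derivative (*) r) (at (x \<bullet> y) within (\<lambda>z. z \<bullet> y) ` sphere 0 1)"
    unfolding has_field_derivative_def by (rule has_derivative_subset)
  from has_derivative_in_compose[OF has_derivative_inner_left[OF has_derivative_ident] this]
  have "((\<lambda>z. \<phi> (z \<bullet> y)) has_derivative (\<lambda>h. r * (h \<bullet> y))) (at x within sphere 0 1)" .
  then have "(f has_derivative (\<lambda>h. r * (h \<bullet> y))) (at x within sphere 0 1)"
    by (rule has_derivative_transform[rotated 2]) (use assms in auto)
  \<comment> \<open>The zero function has derivative \<open>(\<bullet>) x\<close> within the sphere too, so that any multiple of it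
    may be subtracted to make the gradient tangent.\<close>
  moreover have "((\<lambda>z. x \<bullet> z - x \<bullet> z) has_derivative (\<lambda>h. x \<bullet> h - 0)) (at x within sphere 0 1)"
    using has_derivative_inner_right[OF has_derivative_ident]
      has_derivative_inner_within_sphere[OF assms(1)] by (rule has_derivative_diff)
  then have "((\<lambda>z. (r * (x \<bullet> y)) * (x \<bullet> z - x \<bullet> z)) has_derivative
      (\<lambda>h. (r * (x \<bullet> y)) * (x \<bullet> h - 0))) (at x within sphere 0 1)"
    by (rule has_derivative_mult_right)
  ultimately have "((\<lambda>z. f z - (r * (x \<bullet> y)) * (x \<bullet> z - x \<bullet> z)) has_derivative
      (\<lambda>h. r * (h \<bullet> y) - (r * (x \<bullet> y)) * (x \<bullet> h - 0))) (at x within sphere 0 1)"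
    by (rule has_derivative_diff)
  then show "(f has_derivative (\<lambda>h. (r *\<^sub>R (y - (x \<bullet> y) *\<^sub>R x)) \<bullet> h)) (at x within sphere 0 1)"
    by (simp add: inner_diff_left inner_commute algebra_simps)
qed

section \<open>The interaction gradient\<close>

text \<open>
  The derivative of \<open>c \<mapsto> g ((arccos c)\<^sup>2)\<close>; writing \<open>\<theta> / sin \<theta>\<close> through \<open>sinc\<close> covers \<open>\<theta> = 0\<close>.
\<close>

definition kernel_slope :: "(real \<Rightarrow> real) \<Rightarrow> real \<Rightarrow> real" where
  "kernel_slope g' c = - 2 * (g' ((arccos c)\<^sup>2) * inverse (sinc (arccos c)))"

text \<open>
  This is \<open>- 2 * g' (\<theta>\<^sup>2)\<close> times the Riemannian logarithm of \<open>y\<close> at \<open>x\<close>, \<open>\<theta>\<close> being the angle between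
  \<open>x\<close> and \<open>y\<close>.
\<close>

definition kernel_grad :: "(real \<Rightarrow> real) \<Rightarrow> 'a::real_inner \<Rightarrow> 'a \<Rightarrow> 'a" where
  "kernel_grad g' x y = kernel_slope g' (x \<bullet> y) *\<^sub>R (y - (x \<bullet> y) *\<^sub>R x)"

lemma sphere_grad_kernel:
  fixes x y :: "'a::euclidean_space"
  assumes g: "\<And>s. 0 \<le> s \<Longrightarrow> (g has_real_derivative g' s) (at s within {0..})"
    and K: "\<And>z. norm z = 1 \<Longrightarrow> f z = g ((sphere_dist z y)\<^sup>2)"
    and xy: "norm x = 1" "norm y = 1" "-1 < x \<bullet> y"
  shows "sphere_grad f x = kernel_grad g' x y"
  unfolding kernel_grad_def
proof (rule sphere_grad_zonal[OF xy(1,2)])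
  show "f z = g ((arccos (z \<bullet> y))\<^sup>2)" if "norm z = 1" for z
    using K[OF that] by (simp add: sphere_dist_def)
  have "x \<bullet> y \<le> 1" using norm_cauchy_schwarz[of x y] xy by simp
  have sq: "((\<lambda>c. (arccos c)\<^sup>2) has_real_derivative - 2 * inverse (sinc (arccos (x \<bullet> y))))
      (at (x \<bullet> y) within {-1..1})"
    by (rule has_real_derivative_arccos_sq) fact+
  have outer: "(g has_real_derivative g' ((arccos (x \<bullet> y))\<^sup>2))
      (at ((arccos (x \<bullet> y))\<^sup>2) within (\<lambda>c. (arccos c)\<^sup>2) ` {-1..1})"
    by (rule DERIV_subset[OF g]) auto
  show "((\<lambda>c. g ((arccos c)\<^sup>2)) has_real_derivative kernel_slope g' (x \<bullet> y))
      (at (x \<bullet> y) within {-1..1})"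
    using DERIV_image_chain[OF outer sq]
    unfolding kernel_slope_def comp_def by (simp only: mult.left_commute)
qed

lemma bounded_lipschitz_image:
  fixes f :: "'a::metric_space \<Rightarrow> 'b::metric_space"
  assumes "L-lipschitz_on S f" and "bounded S"
  shows "bounded (f ` S)"
proof (cases "S = {}")
  case False
  then obtain a where a: "a \<in> S" by auto
  obtain r where r: "\<And>x. x \<in> S \<Longrightarrow> dist a x \<le> r"
    using assms(2) unfolding bounded_any_center[where a = a] by blast
  have "dist (f a) (f x) \<le> L * r" if "x \<in> S" for x
    using lipschitz_onD[OF assms(1) a that] r[OF that] lipschitz_on_nonneg[OF assms(1)]
    by (meson mult_left_mono order_trans)
  then show ?thesis unfolding bounded_def by blast
qed simp

text \<open>
  Lipschitz functions on a bounded set are bounded, which is what makes the product rule work.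
\<close>

lemma (in bounded_bilinear) lipschitz_on_bounded_set:
  fixes f :: "'d::metric_space \<Rightarrow> 'a" and h :: "'d \<Rightarrow> 'b"
  assumes S: "bounded S" and f: "A-lipschitz_on S f" and h: "B-lipschitz_on S h"
  obtains L where "L-lipschitz_on S (\<lambda>x. prod (f x) (h x))"
proof -
  obtain P where P: "\<And>x. x \<in> S \<Longrightarrow> norm (f x) \<le> P" "0 < P"
    using bounded_lipschitz_image[OF f S] unfolding bounded_pos by auto
  obtain Q where Q: "\<And>x. x \<in> S \<Longrightarrow> norm (h x) \<le> Q" "0 < Q"
    using bounded_lipschitz_image[OF h S] unfolding bounded_pos by auto
  obtain C where C: "0 \<le> C" "\<And>a b. norm (prod a b) \<le> norm a * norm b * C"
    using nonneg_bounded by blast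
  note nn = lipschitz_on_nonneg[OF f] lipschitz_on_nonneg[OF h]
  have "dist (prod (f x) (h x)) (prod (f y) (h y)) \<le> (A * Q * C + P * B * C) * dist x y"
    if "x \<in> S" "y \<in> S" for x y
  proof -
    have fxy: "norm (f x - f y) \<le> A * dist x y" and hxy: "norm (h x - h y) \<le> B * dist x y"
      using lipschitz_onD[OF f that] lipschitz_onD[OF h that] by (simp_all add: dist_norm)
    have "prod (f x) (h x) - prod (f y) (h y) = prod (f x - f y) (h x) + prod (f y) (h x - h y)"
      by (simp add: diff_left diff_right)
    also have "norm \<dots> \<le> norm (f x - f y) * norm (h x) * C + norm (f y) * norm (h x - h y) * C"
      by (intro norm_triangle_le add_mono C)
    also have "\<dots> \<le> (A * dist x y) * Q * C + P * (B * dist x y) * C"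
      using fxy hxy P(1)[OF that(2)] Q(1)[OF that(1)] P(2) Q(2) C(1) nn
      by (intro add_mono mult_mono mult_nonneg_nonneg) auto
    finally show ?thesis by (simp add: dist_norm algebra_simps)
  qed
  then show ?thesis
    using that lipschitz_onI[of S "\<lambda>x. prod (f x) (h x)" "A * Q * C + P * B * C"] P Q C nn by auto
qed

lemma locally_lipschitz_on_compact:
  assumes "locally_lipschitz_on S f" and "compact C" and "C \<subseteq> S"
  obtains L where "L-lipschitz_on C f"
proof -
  have "local_lipschitz {0::real} S (\<lambda>_. f)"
    using assms(1) unfolding local_lipschitz_def locally_lipschitz_on_def by blast
  from local_lipschitz_subset[OF this order_refl assms(3)]
  have "local_lipschitz {0::real} C (\<lambda>_. f)" .
  then show ?thesis
    by (rule local_lipschitz_compact_implies_lipschitz[OF _ assms(2), where T = "{0}"])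
      (use that in auto)
qed

lemma lipschitz_on_kernel_slope:
  assumes "locally_lipschitz_on {0..} g'" and c0: "-1 < c0" "c0 \<le> 1"
  obtains L where "L-lipschitz_on {c0..1} (kernel_slope g')"
proof -
  obtain A where A: "A-lipschitz_on {c0..1} (\<lambda>c. (arccos c)\<^sup>2)"
    using lipschitz_on_arccos_sq[OF c0] by blast
  have "compact ((\<lambda>c. (arccos c)\<^sup>2) ` {c0..1})"
    by (rule compact_continuous_image[OF lipschitz_on_continuous_on[OF A] compact_Icc])
  then obtain G where "G-lipschitz_on ((\<lambda>c. (arccos c)\<^sup>2) ` {c0..1}) g'"
    using locally_lipschitz_on_compact[OF assms(1)] by (metis (no_types, lifting) atLeast_iff image_subsetI zero_le_power2)
  from lipschitz_on_compose2[OF A this] obtain P where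
    P: "P-lipschitz_on {c0..1} (\<lambda>c. g' ((arccos c)\<^sup>2))" by auto
  obtain Q where Q: "Q-lipschitz_on {c0..1} (\<lambda>c. inverse (sinc (arccos c)))"
    using lipschitz_on_inverse_sinc_arccos[OF c0] by blast
  obtain R where "R-lipschitz_on {c0..1} (\<lambda>c. g' ((arccos c)\<^sup>2) * inverse (sinc (arccos c)))"
    using bounded_bilinear.lipschitz_on_bounded_set[OF bounded_bilinear_mult bounded_closed_interval P Q]
    by blast
  from lipschitz_on_cmult_real[OF this, of "-2"]
  have "(\<bar>- 2\<bar> * R)-lipschitz_on {c0..1} (kernel_slope g')"
    unfolding kernel_slope_def .
  then show ?thesis by (rule that)
qed

lemma lipschitz_on_kernel_grad:
  fixes D :: "'a::real_inner set"
  assumes "locally_lipschitz_on {0..} g'" and "-1 < c0"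
    and D: "D \<subseteq> sphere 0 1" "\<And>x y. x \<in> D \<Longrightarrow> y \<in> D \<Longrightarrow> c0 \<le> x \<bullet> y"
  obtains L where "L-lipschitz_on (D \<times> D) (\<lambda>p. kernel_grad g' (fst p) (snd p))"
proof (cases "D = {}")
  case True
  then show ?thesis using that[of 0] by simp
next
  case False
  then obtain x where "x \<in> D" by auto
  then have c0: "c0 \<le> 1" using D(2)[of x x] D(1) by (auto simp: dot_square_norm)
  have bdd: "bounded (D \<times> D)"
    using bounded_subset[OF bounded_cball order_trans[OF D(1) sphere_cball]] by (intro bounded_Times)
  have fst: "1-lipschitz_on (D \<times> D) fst" and snd: "1-lipschitz_on (D \<times> D) snd"
    by (intro lipschitz_onI; simp add: dist_fst_le dist_snd_le)+
  obtain A where A: "A-lipschitz_on (D \<times> D) (\<lambda>p. fst p \<bullet> snd p)"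
    using bounded_bilinear.lipschitz_on_bounded_set[OF bounded_bilinear_inner bdd fst snd] by blast
  have "(\<lambda>p. fst p \<bullet> snd p) ` (D \<times> D) \<subseteq> {c0..1}"
  proof safe
    fix x y assume xy: "x \<in> D" "y \<in> D"
    then have "norm x = 1" "norm y = 1" using D(1) by auto
    then have "x \<bullet> y \<le> 1" using norm_cauchy_schwarz[of x y] by simp
    then show "fst (x, y) \<bullet> snd (x, y) \<in> {c0..1}" using D(2)[OF xy] by simp
  qed
  moreover obtain B where "B-lipschitz_on {c0..1} (kernel_slope g')"
    using lipschitz_on_kernel_slope[OF assms(1,2) c0] by blast
  ultimately have slope: "(B * A)-lipschitz_on (D \<times> D) (\<lambda>p. kernel_slope g' (fst p \<bullet> snd p))"
    using lipschitz_on_compose2[OF A lipschitz_on_subset] by blast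
  obtain C where "C-lipschitz_on (D \<times> D) (\<lambda>p. (fst p \<bullet> snd p) *\<^sub>R fst p)"
    using bounded_bilinear.lipschitz_on_bounded_set[OF bounded_bilinear_scaleR bdd A fst] by blast
  from lipschitz_on_diff[OF snd this]
  have "(1 + C)-lipschitz_on (D \<times> D) (\<lambda>p. snd p - (fst p \<bullet> snd p) *\<^sub>R fst p)" .
  then obtain L where "L-lipschitz_on (D \<times> D)
      (\<lambda>p. kernel_slope g' (fst p \<bullet> snd p) *\<^sub>R (snd p - (fst p \<bullet> snd p) *\<^sub>R fst p))"
    by (rule bounded_bilinear.lipschitz_on_bounded_set[OF bounded_bilinear_scaleR bdd slope])
  then show ?thesis by (rule that[unfolded kernel_grad_def])
qed

section \<open>Geometry of the cap\<close>

lemma cap_subset_sphere: "cap \<epsilon> \<subseteq> sphere 0 1"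
  by (auto simp: cap_def)

text \<open>
  Points of the cap have height at least \<open>sin \<epsilon>\<close> and horizontal part at most \<open>cos \<epsilon>\<close>, so their inner
  product is at least \<open>(sin \<epsilon>)\<^sup>2 - (cos \<epsilon>)\<^sup>2\<close>.  In particular no two of them are nearly antipodal.
\<close>

lemma inner_cap_ge:
  fixes x y :: "(real ^ 'k) \<times> real"
  assumes "0 < \<epsilon>" "\<epsilon> < pi / 2" and x: "x \<in> cap \<epsilon>" and y: "y \<in> cap \<epsilon>"
  shows "2 * (sin \<epsilon>)\<^sup>2 - 1 \<le> x \<bullet> y"
proof -
  have height: "sin \<epsilon> < snd z \<and> norm (fst z) \<le> cos \<epsilon> \<and> norm z = 1" if "z \<in> cap \<epsilon>" for z :: "(real ^ 'k) \<times> real"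
  proof -
    have z: "norm z = 1" "arccos (snd z) < pi / 2 - \<epsilon>"
      using that by (auto simp: cap_def sphere_dist_def north_pole_def inner_prod_def)
    have sq: "(norm (fst z))\<^sup>2 + (snd z)\<^sup>2 = 1"
      using z(1) by (simp add: norm_prod_def)
    then have "(snd z)\<^sup>2 \<le> 1" by (smt (verit) zero_le_power2)
    then have abs: "-1 \<le> snd z" "snd z \<le> 1" by (simp_all add: abs_square_le_1 abs_le_iff)
    have "cos (pi / 2 - \<epsilon>) < cos (arccos (snd z))"
      using z(2) assms(1) arccos_lbound[OF abs] by (intro cos_monotone_0_pi) auto
    then have h: "sin \<epsilon> < snd z" using abs by (simp add: cos_diff)
    have "0 < sin \<epsilon>" "0 < cos \<epsilon>" using assms sin_gt_zero[of \<epsilon>] cos_gt_zero[of \<epsilon>] by auto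
    then have "(sin \<epsilon>)\<^sup>2 \<le> (snd z)\<^sup>2" using h by (intro power_mono) auto
    then have "(norm (fst z))\<^sup>2 \<le> (cos \<epsilon>)\<^sup>2"
      using sq sin_cos_squared_add[of \<epsilon>] by linarith
    then have "norm (fst z) \<le> cos \<epsilon>" by (rule power2_le_imp_le) (use \<open>0 < cos \<epsilon>\<close> in simp)
    then show ?thesis using h z by simp
  qed
  have "0 < sin \<epsilon>" using assms sin_gt_zero[of \<epsilon>] by auto
  have "0 \<le> cos \<epsilon>" using assms by (intro cos_ge_zero) auto
  have "\<bar>fst x \<bullet> fst y\<bar> \<le> norm (fst x) * norm (fst y)" by (rule Cauchy_Schwarz_ineq2)
  also have "\<dots> \<le> cos \<epsilon> * cos \<epsilon>"
    using height[OF x] height[OF y] \<open>0 \<le> cos \<epsilon>\<close> by (intro mult_mono) auto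
  finally have "\<bar>fst x \<bullet> fst y\<bar> \<le> 1 - (sin \<epsilon>)\<^sup>2" by (simp add: cos_squared_eq flip: power2_eq_square)
  moreover have "(sin \<epsilon>)\<^sup>2 \<le> snd x * snd y"
    unfolding power2_eq_square using height[OF x] height[OF y] \<open>0 < sin \<epsilon>\<close> by (intro mult_mono) auto
  ultimately show ?thesis by (simp add: inner_prod_def)
qed

lemma norm_diff_sphere:
  fixes x y :: "'a::real_inner"
  assumes "norm x = 1" "norm y = 1"
  shows "(norm (x - y))\<^sup>2 = 2 * (1 - x \<bullet> y)"
  using assms dot_norm_neg[of x y] by simp

lemma norm_diff_le_sphere_dist:
  fixes x y :: "'a::real_inner"
  assumes "norm x = 1" "norm y = 1"
  shows "norm (x - y) \<le> sphere_dist x y"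
proof -
  have c: "-1 \<le> x \<bullet> y" "x \<bullet> y \<le> 1"
    using Cauchy_Schwarz_ineq2[of x y] assms by auto
  define h where "h = sphere_dist x y / 2"
  have h: "0 \<le> h" using arccos_lbound[OF c] by (simp add: h_def sphere_dist_def)
  have "x \<bullet> y = cos (2 * h)" using c by (simp add: h_def sphere_dist_def)
  then have "(norm (x - y))\<^sup>2 = (2 * sin h)\<^sup>2"
    unfolding norm_diff_sphere[OF assms] cos_double_sin by (simp add: power_mult_distrib)
  also have "\<dots> \<le> (2 * h)\<^sup>2"
    using abs_sin_x_le_abs_x[of h] by (intro abs_le_square_iff[THEN iffD1]) (simp add: abs_mult)
  finally have "norm (x - y) \<le> 2 * h" by (rule power2_le_imp_le) (use h in simp)
  then show ?thesis by (simp add: h_def)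
qed

text \<open>
  Both the square of the angle (by its Lipschitz bound) and \<open>(norm (x - y))\<^sup>2\<close> are comparable with
  \<open>1 - x \<bullet> y\<close>.
\<close>

lemma sphere_dist_le_norm_diff:
  assumes "-1 < c0"
  obtains C where "0 < C"
    and "\<And>x y :: 'a::real_inner. norm x = 1 \<Longrightarrow> norm y = 1 \<Longrightarrow> c0 \<le> x \<bullet> y \<Longrightarrow>
      sphere_dist x y \<le> C * norm (x - y)"
proof (cases "c0 \<le> 1")
  case True
  obtain L where L: "L-lipschitz_on {c0..1} (\<lambda>c. (arccos c)\<^sup>2)"
    using lipschitz_on_arccos_sq[OF assms True] by blast
  have "sphere_dist x y \<le> (L + 1) * norm (x - y)"
    if xy: "norm x = 1" "norm y = 1" "c0 \<le> x \<bullet> y" for x y :: 'a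
  proof -
    have c: "x \<bullet> y \<le> 1" using norm_cauchy_schwarz[of x y] xy by simp
    have "(arccos (x \<bullet> y))\<^sup>2 \<le> L * (1 - x \<bullet> y)"
      using lipschitz_onD[OF L, of "x \<bullet> y" 1] xy c by (simp add: dist_real_def)
    also have "\<dots> \<le> (L + 1)\<^sup>2 * (norm (x - y))\<^sup>2"
      unfolding norm_diff_sphere[OF xy(1,2)]
      using lipschitz_on_nonneg[OF L] c mult_right_mono[of L "(L + 1)\<^sup>2 * 2" "1 - x \<bullet> y"]
      by (simp add: power2_eq_square algebra_simps)
    also have "\<dots> = ((L + 1) * norm (x - y))\<^sup>2" by (simp only: power_mult_distrib)
    finally show ?thesis
      unfolding sphere_dist_def
      by (rule power2_le_imp_le) (use lipschitz_on_nonneg[OF L] in simp)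
  qed
  then show ?thesis using that[of "L + 1"] lipschitz_on_nonneg[OF L] by simp
next
  case False
  have "\<not> c0 \<le> x \<bullet> y" if "norm x = 1" "norm y = 1" for x y :: 'a
    using False norm_cauchy_schwarz[of x y] that by simp
  then show ?thesis using that[of 1] by auto
qed

section \<open>Flows of weak solutions\<close>

text \<open>
  The complement of the support is covered by the null sets of a countable basis.
\<close>

lemma null_sets_complement_supp:
  fixes \<mu> :: "'a::second_countable_topology measure"
  assumes "sets \<mu> = sets (restrict_space borel D)"
  shows "space \<mu> - supp \<mu> \<in> null_sets \<mu>"
proof -
  obtain \<B> :: "'a set set" where \<B>: "countable \<B>" "\<And>B. B \<in> \<B> \<Longrightarrow> open B"
    "\<And>S. open S \<Longrightarrow> \<exists>U. U \<subseteq> \<B> \<and> S = \<Union>U"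
    using univ_second_countable by metis
  define \<N> where "\<N> = {B \<in> \<B>. emeasure \<mu> (B \<inter> space \<mu>) = 0}"
  have space: "space \<mu> = D" using sets_eq_imp_space_eq[OF assms] by (simp add: space_restrict_space)
  have "B \<inter> space \<mu> \<in> sets \<mu>" if "B \<in> \<B>" for B
    using \<B>(2)[OF that] unfolding assms space sets_restrict_space by auto
  then have "(\<Union>B\<in>\<N>. B \<inter> space \<mu>) \<in> null_sets \<mu>"
    using \<B>(1) by (intro null_sets_UN') (auto simp: \<N>_def intro!: null_setsI countable_Collect)
  moreover have "space \<mu> - supp \<mu> = (\<Union>B\<in>\<N>. B \<inter> space \<mu>)"
  proof (intro equalityI subsetI)
    fix x assume x: "x \<in> space \<mu> - supp \<mu>"
    then obtain U where U: "open U" "x \<in> U" "emeasure \<mu> (U \<inter> space \<mu>) = 0"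
      by (auto simp: supp_def)
    then obtain B where B: "B \<in> \<B>" "x \<in> B" "B \<subseteq> U" using \<B>(3)[of U] by blast
    have "emeasure \<mu> (B \<inter> space \<mu>) \<le> emeasure \<mu> (U \<inter> space \<mu>)"
      using B(3) U(1) unfolding space
      by (intro emeasure_mono) (auto simp: assms sets_restrict_space)
    then have "B \<in> \<N>" using B U by (simp add: \<N>_def)
    then show "x \<in> (\<Union>B\<in>\<N>. B \<inter> space \<mu>)" using B x by auto
  next
    fix x assume "x \<in> (\<Union>B\<in>\<N>. B \<inter> space \<mu>)"
    then show "x \<in> space \<mu> - supp \<mu>"
      using \<B>(2) by (fastforce simp: \<N>_def supp_def)
  qed
  ultimately show ?thesis by simp
qed

text \<open>
  A map given on the support only may be continued by a constant outside, as the support has full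
  measure.  This allows working with measurable self-maps of \<open>D\<close> and plain image measures.
\<close>

lemma push_forward_extension:
  fixes \<mu> :: "'a::second_countable_topology measure"
  assumes \<mu>: "\<mu> \<in> prob_measures D" and push: "is_push_forward D f \<mu> \<nu>" and "d \<in> D"
  defines "h \<equiv> \<lambda>x. if x \<in> supp \<mu> then f x else d"
  shows "h \<in> restrict_space borel D \<rightarrow>\<^sub>M restrict_space borel D"
    and "\<nu> = distr \<mu> (restrict_space borel D) h"
proof -
  let ?M = "restrict_space borel D :: 'a measure"
  have sets: "sets \<mu> = sets ?M" using \<mu> by (simp add: prob_measures_def)
  have null: "space \<mu> - supp \<mu> \<in> null_sets \<mu>" by (rule null_sets_complement_supp[OF sets])
  have sub: "supp \<mu> \<subseteq> space \<mu>" by (auto simp: supp_def)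
  have "supp \<mu> = space \<mu> - (space \<mu> - supp \<mu>)" using sub by auto
  then have supp: "supp \<mu> \<in> sets \<mu>" using null by (metis null_setsD2 sets.compl_sets)
  have f: "f \<in> restrict_space \<mu> (supp \<mu>) \<rightarrow>\<^sub>M ?M" and \<nu>: "\<nu> = distr (restrict_space \<mu> (supp \<mu>)) ?M f"
    using push by (simp_all add: is_push_forward_def)
  have h: "h \<in> \<mu> \<rightarrow>\<^sub>M ?M"
    unfolding h_def using f supp sub \<open>d \<in> D\<close>
    by (subst measurable_restrict_space_iff[symmetric]) (auto simp: Int_absorb2 space_restrict_space)
  then show "h \<in> ?M \<rightarrow>\<^sub>M ?M"
    by (simp add: measurable_cong_sets[OF sets refl])
  show "\<nu> = distr \<mu> ?M h"
  proof (rule measure_eqI)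
    fix A assume "A \<in> sets \<nu>"
    then have A: "A \<in> sets ?M" by (simp add: \<nu>)
    have 1: "f -` A \<inter> supp \<mu> \<in> sets \<mu>"
      using measurable_sets[OF f A] supp sub
      by (simp add: space_restrict_space Int_absorb2 sets_restrict_space_iff)
    have "emeasure \<nu> A = emeasure \<mu> (f -` A \<inter> supp \<mu>)"
      unfolding \<nu> using f A supp sub
      by (simp add: emeasure_distr space_restrict_space Int_absorb2 emeasure_restrict_space)
    also have "\<dots> = emeasure \<mu> (h -` A \<inter> space \<mu>)"
    proof (rule emeasure_eq_AE)
      show "AE x in \<mu>. x \<in> f -` A \<inter> supp \<mu> \<longleftrightarrow> x \<in> h -` A \<inter> space \<mu>"
        by (rule AE_I'[OF null]) (use sub in \<open>auto simp: h_def\<close>)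
    qed (use 1 measurable_sets[OF h A] in auto)
    also have "\<dots> = emeasure (distr \<mu> ?M h) A"
      using h A by (simp add: emeasure_distr)
    finally show "emeasure \<nu> A = emeasure (distr \<mu> ?M h) A" .
  qed (simp add: \<nu>)
qed

text \<open>
  The flow whose velocity at time \<open>t\<close> is minus the average of \<open>F\<close> over its own image measure.  By the substitution rule the
  velocity is an integral over the initial measure \<open>\<mu>\<close>, so the curve of image measures no longer
  appears; the equations are demanded almost everywhere because a flow map starts on the support
  only.
\<close>

definition self_consistent_flow ::
  "('a::euclidean_space \<Rightarrow> 'a \<Rightarrow> 'a) \<Rightarrow> 'a set \<Rightarrow> real \<Rightarrow> 'a measure \<Rightarrow> (real \<Rightarrow> 'a \<Rightarrow> 'a) \<Rightarrow> bool"
where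
  "self_consistent_flow F D T \<mu> \<Phi> \<longleftrightarrow>
    (\<forall>t\<in>{0..<T}. \<Phi> t \<in> restrict_space borel D \<rightarrow>\<^sub>M restrict_space borel D) \<and>
    (AE x in \<mu>. \<Phi> 0 x = x \<and> (\<forall>t\<in>{0..<T}.
      ((\<lambda>s. \<Phi> s x) has_vector_derivative - (\<integral>y. F (\<Phi> t x) (\<Phi> t y) \<partial>\<mu>)) (at t within {0..<T})))"

lemma weak_solution_imp_self_consistent_flow:
  fixes K :: "'a::euclidean_space \<Rightarrow> 'a \<Rightarrow> real"
  assumes sol: "weak_solution D K T \<mu> \<rho>" and \<mu>: "\<mu> \<in> prob_measures D"
    and F: "\<And>x y. x \<in> D \<Longrightarrow> y \<in> D \<Longrightarrow> sphere_grad (\<lambda>z. K z y) x = F x y"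
    and F_cont: "\<And>x. x \<in> D \<Longrightarrow> continuous_on D (F x)"
  obtains \<Phi> where "self_consistent_flow F D T \<mu> \<Phi>"
    and "\<And>t. t \<in> {0..<T} \<Longrightarrow> \<rho> t = distr \<mu> (restrict_space borel D) (\<Phi> t)"
proof -
  let ?M = "restrict_space borel D :: 'a measure"
  have sets: "sets \<mu> = sets ?M" and prob: "prob_space \<mu>" using \<mu> by (simp_all add: prob_measures_def)
  have space: "space \<mu> = D" using sets_eq_imp_space_eq[OF sets] by (simp add: space_restrict_space)
  obtain d where d: "d \<in> D" using prob_space.not_empty[OF prob] space by auto
  obtain \<Psi> where flow: "flow_map D (velocity K \<rho>) (supp \<mu>) T \<Psi>"
    and push: "\<And>t. t \<in> {0..<T} \<Longrightarrow> is_push_forward D (\<Psi> t) \<mu> (\<rho> t)"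
    using sol by (auto simp: weak_solution_def unique_flow_map_def)
  define \<Phi> where "\<Phi> = (\<lambda>t x. if x \<in> supp \<mu> then \<Psi> t x else d)"
  have meas: "\<Phi> t \<in> ?M \<rightarrow>\<^sub>M ?M" and \<rho>: "\<rho> t = distr \<mu> ?M (\<Phi> t)" if "t \<in> {0..<T}" for t
    using push_forward_extension[OF \<mu> push[OF that] d] unfolding \<Phi>_def by auto
  have vel: "velocity K \<rho> x t = - (\<integral>y. F x (\<Phi> t y) \<partial>\<mu>)" if t: "t \<in> {0..<T}" and x: "x \<in> D" for x t
  proof -
    have "(\<integral>y. sphere_grad (\<lambda>z. K z y) x \<partial>\<rho> t) = (\<integral>y. F x y \<partial>\<rho> t)"
      by (rule Bochner_Integration.integral_cong[OF refl]) (use F[OF x] in \<open>simp add: \<rho>[OF t] space_restrict_space\<close>)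
    also have "\<dots> = (\<integral>y. F x (\<Phi> t y) \<partial>\<mu>)"
      unfolding \<rho>[OF t]
    proof (rule integral_distr)
      show "\<Phi> t \<in> \<mu> \<rightarrow>\<^sub>M ?M" using meas[OF t] by (simp add: measurable_cong_sets[OF sets refl])
      show "F x \<in> borel_measurable ?M" by (rule borel_measurable_continuous_on_restrict[OF F_cont[OF x]])
    qed
    finally show ?thesis by (simp add: velocity_def)
  qed
  have "AE x in \<mu>. x \<in> supp \<mu>"
    by (rule AE_I'[OF null_sets_complement_supp[OF sets]]) auto
  then have "AE x in \<mu>. \<Phi> 0 x = x \<and> (\<forall>t\<in>{0..<T}.
      ((\<lambda>s. \<Phi> s x) has_vector_derivative - (\<integral>y. F (\<Phi> t x) (\<Phi> t y) \<partial>\<mu>)) (at t within {0..<T}))"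
  proof (eventually_elim, intro conjI ballI)
    fix x assume x: "x \<in> supp \<mu>"
    then show "\<Phi> 0 x = x" using flow by (simp add: flow_map_def \<Phi>_def)
    fix t assume t: "t \<in> {0..<T}"
    have "\<Psi> t x \<in> D" and "((\<lambda>s. \<Psi> s x) has_vector_derivative velocity K \<rho> (\<Psi> t x) t) (at t within {0..<T})"
      using flow x t by (simp_all add: flow_map_def)
    then show "((\<lambda>s. \<Phi> s x) has_vector_derivative - (\<integral>y. F (\<Phi> t x) (\<Phi> t y) \<partial>\<mu>)) (at t within {0..<T})"
      using vel[OF t, of "\<Psi> t x"] x by (simp add: \<Phi>_def)
  qed
  then have "self_consistent_flow F D T \<mu> \<Phi>" using meas by (simp add: self_consistent_flow_def)
  then show ?thesis using \<rho> by (rule that)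
qed

section \<open>Stability under coupling\<close>

text \<open>
  Cut \<open>[0, t]\<close> into \<open>n\<close> equal steps.  The quadratic errors add up to at most
  \<open>exp (A * t) * B * t\<^sup>2 / n\<close>, which vanishes as \<open>n\<close> grows.
\<close>

lemma gronwall_quadratic_error:
  fixes e :: "real \<Rightarrow> real"
  assumes "0 \<le> A" and "0 \<le> B" and "0 \<le> e 0" and "0 \<le> t"
    and step: "\<And>s r. 0 \<le> s \<Longrightarrow> s \<le> r \<Longrightarrow> r \<le> t \<Longrightarrow> e r \<le> (1 + A * (r - s)) * e s + B * (r - s)\<^sup>2"
  shows "e t \<le> exp (A * t) * e 0"
proof -
  have bound: "e t \<le> exp (A * t) * (e 0 + B * t\<^sup>2 / real n)" if "0 < n" for n :: nat
  proof -
    define h where "h = t / real n"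
    have h: "0 \<le> h" "real n * h = t" using that assms(4) by (simp_all add: h_def)
    have "e (real k * h) \<le> (1 + A * h) ^ k * (e 0 + real k * (B * h\<^sup>2))" if "k \<le> n" for k
      using that
    proof (induction k)
      case (Suc k)
      have "real (Suc k) * h \<le> real n * h" using Suc.prems h(1) by (intro mult_right_mono) auto
      then have "e (real (Suc k) * h) \<le> (1 + A * h) * e (real k * h) + B * h\<^sup>2"
        using step[of "real k * h" "real (Suc k) * h"] h by (simp add: algebra_simps)
      also have "\<dots> \<le> (1 + A * h) * ((1 + A * h) ^ k * (e 0 + real k * (B * h\<^sup>2))) + (1 + A * h) ^ Suc k * (B * h\<^sup>2)"
      proof (rule add_mono)
        show "(1 + A * h) * e (real k * h) \<le> (1 + A * h) * ((1 + A * h) ^ k * (e 0 + real k * (B * h\<^sup>2)))"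
          using Suc h assms(1) by (intro mult_left_mono) auto
        have "1 \<le> (1 + A * h) ^ Suc k" using assms(1) h by (intro one_le_power) auto
        then show "B * h\<^sup>2 \<le> (1 + A * h) ^ Suc k * (B * h\<^sup>2)"
          using assms(2) mult_right_mono[of 1 "(1 + A * h) ^ Suc k" "B * h\<^sup>2"] by simp
      qed
      finally show ?case by (simp add: algebra_simps)
    qed simp
    from this[of n] have "e t \<le> (1 + A * h) ^ n * (e 0 + real n * (B * h\<^sup>2))" using h by simp
    also have "\<dots> \<le> exp (A * h) ^ n * (e 0 + real n * (B * h\<^sup>2))"
      using assms(1-3) h exp_ge_add_one_self[of "A * h"]
      by (intro mult_right_mono power_mono) auto
    also have "exp (A * h) ^ n = exp (A * t)"
      using h(2) by (simp add: exp_of_nat_mult[symmetric] mult.left_commute)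
    also have "real n * (B * h\<^sup>2) = B * t\<^sup>2 / real n"
      using that by (simp add: h_def power2_eq_square)
    finally show ?thesis .
  qed
  have "(\<lambda>n. B * t\<^sup>2 / real n) \<longlonglongrightarrow> 0"
    by (rule lim_const_over_n)
  then have "(\<lambda>n. exp (A * t) * (e 0 + B * t\<^sup>2 / real n)) \<longlonglongrightarrow> exp (A * t) * (e 0 + 0)"
    by (intro tendsto_intros)
  then have "e t \<le> exp (A * t) * (e 0 + 0)"
    by (rule LIMSEQ_le_const) (use bound in \<open>auto intro!: exI[of _ 1]\<close>)
  then show ?thesis by simp
qed

lemma has_vector_derivative_increment_le:
  fixes f :: "real \<Rightarrow> 'a::real_normed_vector"
  assumes "s \<le> t"
    and "\<And>r. r \<in> {s..t} \<Longrightarrow> (f has_vector_derivative f' r) (at r within {s..t})"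
    and "\<And>r. r \<in> {s..t} \<Longrightarrow> norm (f' r) \<le> B"
  shows "norm (f t - f s) \<le> B * (t - s)"
proof -
  have "norm (f t - f s) \<le> B * norm (t - s)"
  proof (rule differentiable_bound[where S = "{s..t}" and f' = "\<lambda>r h. h *\<^sub>R f' r"])
    fix r assume r: "r \<in> {s..t}"
    show "onorm (\<lambda>h. h *\<^sub>R f' r) \<le> B"
      using mult_right_mono[OF assms(3)[OF r], of "\<bar>h\<bar>" for h]
      by (intro onorm_le) (simp add: mult.commute)
  qed (use assms in \<open>auto simp: has_vector_derivative_def\<close>)
  then show ?thesis using assms(1) by simp
qed

text \<open>
  The constant \<open>2 * L\<close> has one \<open>L\<close> from the change of the position at which the velocity is evaluated
  and one from the change of the measure that generates it.
\<close>

lemma self_consistent_flow_stability: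
  fixes F :: "'a::euclidean_space \<Rightarrow> 'a \<Rightarrow> 'a" and \<mu> \<nu> :: "'a measure"
  assumes bdd: "bounded D"
    and F: "L-lipschitz_on (D \<times> D) (\<lambda>p. F (fst p) (snd p))"
    and \<mu>: "\<mu> \<in> prob_measures D" and \<nu>: "\<nu> \<in> prob_measures D"
    and \<Phi>: "self_consistent_flow F D T \<mu> \<Phi>" and \<Psi>: "self_consistent_flow F D T \<nu> \<Psi>"
    and \<gamma>: "\<gamma> \<in> transport_plans \<mu> \<nu>"
    and t: "0 \<le> t" "t < T"
  shows "(\<integral>p. norm (\<Phi> t (fst p) - \<Psi> t (snd p)) \<partial>\<gamma>) \<le> exp (2 * L * t) * (\<integral>p. norm (fst p - snd p) \<partial>\<gamma>)"
proof -
  let ?M = "restrict_space borel D :: 'a measure"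
  have sets: "sets \<mu> = sets ?M" "sets \<nu> = sets ?M" using \<mu> \<nu> by (simp_all add: prob_measures_def)
  have \<gamma>': "prob_space \<gamma>" "distr \<gamma> \<mu> fst = \<mu>" "distr \<gamma> \<nu> snd = \<nu>" "sets \<gamma> = sets (\<mu> \<Otimes>\<^sub>M \<nu>)"
    using \<gamma> by (simp_all add: transport_plans_def)
  interpret \<gamma>: prob_space \<gamma> by fact
  have s\<gamma>: "sets \<gamma> = sets (?M \<Otimes>\<^sub>M ?M)" using \<gamma>'(4) sets_pair_measure_cong[OF sets] by simp
  have space: "space \<gamma> = D \<times> D"
    using sets_eq_imp_space_eq[OF s\<gamma>] by (simp add: space_pair_measure space_restrict_space)
  have fm: "fst \<in> \<gamma> \<rightarrow>\<^sub>M \<mu>" "snd \<in> \<gamma> \<rightarrow>\<^sub>M \<nu>" "fst \<in> \<gamma> \<rightarrow>\<^sub>M ?M" "snd \<in> \<gamma> \<rightarrow>\<^sub>M ?M"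
    by (simp_all add: measurable_cong_sets[OF s\<gamma> refl] measurable_cong_sets[OF refl sets(1)]
        measurable_cong_sets[OF refl sets(2)])
  have L: "0 \<le> L" by (rule lipschitz_on_nonneg[OF F])
  obtain R where R: "\<And>x. x \<in> D \<Longrightarrow> norm x \<le> R"
    using bdd unfolding bounded_iff by auto
  obtain C where C: "0 < C" "\<And>x y. x \<in> D \<Longrightarrow> y \<in> D \<Longrightarrow> norm (F x y) \<le> C"
    using bounded_lipschitz_image[OF F bounded_Times[OF bdd bdd]] unfolding bounded_pos by auto
  have F_diff: "norm (F x y - F x' y') \<le> L * (norm (x - x') + norm (y - y'))"
    if "x \<in> D" "y \<in> D" "x' \<in> D" "y' \<in> D" for x y x' y'
  proof -
    have "dist (F x y) (F x' y') \<le> L * dist (x, y) (x', y')"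
      using lipschitz_onD[OF F, of "(x, y)" "(x', y')"] that by simp
    also have "\<dots> \<le> L * (dist x x' + dist y y')"
      unfolding dist_Pair_Pair by (intro mult_left_mono sqrt_sum_squares_le_sum L) auto
    finally show ?thesis by (simp add: dist_norm)
  qed
  have F_cont: "continuous_on D (F x)" if "x \<in> D" for x
  proof (rule lipschitz_on_continuous_on)
    show "L-lipschitz_on D (F x)"
      using F_diff[OF that _ that] L by (intro lipschitz_onI) (simp_all add: dist_norm)
  qed

  have \<Phi>m: "\<Phi> s \<in> ?M \<rightarrow>\<^sub>M ?M" and \<Psi>m: "\<Psi> s \<in> ?M \<rightarrow>\<^sub>M ?M" if "0 \<le> s" "s < T" for s
    using \<Phi> \<Psi> that by (simp_all add: self_consistent_flow_def)
  have \<Phi>D: "\<Phi> s x \<in> D" and \<Psi>D: "\<Psi> s x \<in> D" if "0 \<le> s" "s < T" "x \<in> D" for s x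
    using measurable_space[OF \<Phi>m[OF that(1,2)], of x] measurable_space[OF \<Psi>m[OF that(1,2)], of x] that(3)
    by (simp_all add: space_restrict_space)

  \<comment> \<open>The velocity fields of both flows, written as integrals over the same measure \<open>\<gamma>\<close>.\<close>
  define X where "X = (\<lambda>s z. - (\<integral>q. F z (\<Phi> s (fst q)) \<partial>\<gamma>))"
  define Y where "Y = (\<lambda>s z. - (\<integral>q. F z (\<Psi> s (snd q)) \<partial>\<gamma>))"
  have \<Phi>\<gamma>: "(\<lambda>q. \<Phi> s (fst q)) \<in> \<gamma> \<rightarrow>\<^sub>M ?M" and \<Psi>\<gamma>: "(\<lambda>q. \<Psi> s (snd q)) \<in> \<gamma> \<rightarrow>\<^sub>M ?M"
    if "0 \<le> s" "s < T" for s
    using measurable_compose[OF fm(3) \<Phi>m[OF that]] measurable_compose[OF fm(4) \<Psi>m[OF that]] by auto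
  have Fm: "F z \<in> borel_measurable ?M" if "z \<in> D" for z
    by (rule borel_measurable_continuous_on_restrict[OF F_cont[OF that]])
  have int\<Phi>: "integrable \<gamma> (\<lambda>q. F z (\<Phi> s (fst q)))" and int\<Psi>: "integrable \<gamma> (\<lambda>q. F z (\<Psi> s (snd q)))"
    if "0 \<le> s" "s < T" "z \<in> D" for s z
    by (rule \<gamma>.integrable_const_bound[where B = C],
        auto intro!: AE_I2 C measurable_compose[OF \<Phi>\<gamma> Fm] measurable_compose[OF \<Psi>\<gamma> Fm]
          simp: that space \<Phi>D \<Psi>D)+
  have vel\<Phi>: "- (\<integral>y. F z (\<Phi> s y) \<partial>\<mu>) = X s z" and vel\<Psi>: "- (\<integral>y. F z (\<Psi> s y) \<partial>\<nu>) = Y s z"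
    if "0 \<le> s" "s < T" "z \<in> D" for s z
  proof -
    have "(\<lambda>y. F z (\<Phi> s y)) \<in> borel_measurable \<mu>" "(\<lambda>y. F z (\<Psi> s y)) \<in> borel_measurable \<nu>"
      using measurable_compose[OF \<Phi>m Fm] measurable_compose[OF \<Psi>m Fm] that
      by (simp_all add: measurable_cong_sets[OF sets(1) refl] measurable_cong_sets[OF sets(2) refl])
    from integral_distr[OF fm(1) this(1)] integral_distr[OF fm(2) this(2)]
    show "- (\<integral>y. F z (\<Phi> s y) \<partial>\<mu>) = X s z" "- (\<integral>y. F z (\<Psi> s y) \<partial>\<nu>) = Y s z"
      by (simp_all add: X_def Y_def \<gamma>'(2,3))
  qed

  define u where "u = (\<lambda>s p. norm (\<Phi> s (fst p) - \<Psi> s (snd p)))"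
  define e where "e = (\<lambda>s. \<integral>p. u s p \<partial>\<gamma>)"
  have u_int: "integrable \<gamma> (u s)" if "0 \<le> s" "s < T" for s
  proof (rule \<gamma>.integrable_const_bound[where B = "R + R"])
    show "AE p in \<gamma>. norm (u s p) \<le> R + R"
    proof (rule AE_I2)
      fix p assume "p \<in> space \<gamma>"
      then have "norm (\<Phi> s (fst p)) \<le> R" "norm (\<Psi> s (snd p)) \<le> R"
        using that by (auto simp: space intro!: R \<Phi>D \<Psi>D)
      then show "norm (u s p) \<le> R + R"
        unfolding u_def real_norm_def abs_norm_cancel by (intro norm_triangle_le_diff add_mono)
    qed
    have "(\<lambda>q. \<Phi> s (fst q)) \<in> borel_measurable \<gamma>" "(\<lambda>q. \<Psi> s (snd q)) \<in> borel_measurable \<gamma>"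
      using \<Phi>\<gamma>[OF that] \<Psi>\<gamma>[OF that] by (simp_all add: measurable_restrict_space2_iff)
    then show "u s \<in> borel_measurable \<gamma>" unfolding u_def by measurable
  qed

  have X_bound: "norm (X s z) \<le> C" and Y_bound: "norm (Y s z) \<le> C"
    if "0 \<le> s" "s < T" "z \<in> D" for s z
  proof -
    have "norm (\<integral>q. F z (\<Phi> s (fst q)) \<partial>\<gamma>) \<le> (\<integral>q. C \<partial>\<gamma>)"
      using that by (intro Bochner_Integration.integral_norm_bound_integral int\<Phi>) (auto simp: space intro!: C \<Phi>D)
    then show "norm (X s z) \<le> C" by (simp add: X_def \<gamma>.prob_space)
    have "norm (\<integral>q. F z (\<Psi> s (snd q)) \<partial>\<gamma>) \<le> (\<integral>q. C \<partial>\<gamma>)"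
      using that by (intro Bochner_Integration.integral_norm_bound_integral int\<Psi>) (auto simp: space intro!: C \<Psi>D)
    then show "norm (Y s z) \<le> C" by (simp add: Y_def \<gamma>.prob_space)
  qed
  have XY_diff: "norm (X s z - Y s w) \<le> L * (norm (z - w) + e s)"
    if s: "0 \<le> s" "s < T" and zw: "z \<in> D" "w \<in> D" for s z w
  proof -
    have "X s z - Y s w = - (\<integral>q. F z (\<Phi> s (fst q)) - F w (\<Psi> s (snd q)) \<partial>\<gamma>)"
      using int\<Phi>[OF s zw(1)] int\<Psi>[OF s zw(2)] by (simp add: X_def Y_def)
    then have "norm (X s z - Y s w) = norm (\<integral>q. F z (\<Phi> s (fst q)) - F w (\<Psi> s (snd q)) \<partial>\<gamma>)"
      by simp
    also have "\<dots> \<le> (\<integral>q. L * (norm (z - w) + u s q) \<partial>\<gamma>)"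
      using s zw u_int[OF s]
      by (intro Bochner_Integration.integral_norm_bound_integral Bochner_Integration.integrable_diff int\<Phi> int\<Psi>)
        (auto simp: space u_def intro!: F_diff \<Phi>D \<Psi>D)
    also have "\<dots> = L * (norm (z - w) + e s)"
      using u_int[OF s] by (simp add: e_def \<gamma>.prob_space)
    finally show ?thesis .
  qed

  define good where "good = (\<lambda>p. p \<in> D \<times> D \<and> \<Phi> 0 (fst p) = fst p \<and> \<Psi> 0 (snd p) = snd p \<and>
    (\<forall>s\<in>{0..<T}.
      ((\<lambda>s. \<Phi> s (fst p) - \<Psi> s (snd p)) has_vector_derivative
        X s (\<Phi> s (fst p)) - Y s (\<Psi> s (snd p))) (at s within {0..<T})))"
  have good: "AE p in \<gamma>. good p"
  proof -
    have "AE x in distr \<gamma> \<mu> fst. \<Phi> 0 x = x \<and> (\<forall>s\<in>{0..<T}.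
      ((\<lambda>s. \<Phi> s x) has_vector_derivative - (\<integral>y. F (\<Phi> s x) (\<Phi> s y) \<partial>\<mu>)) (at s within {0..<T}))"
      using \<Phi> unfolding \<gamma>'(2) by (simp add: self_consistent_flow_def)
    note 1 = AE_distrD[OF fm(1) this]
    have "AE x in distr \<gamma> \<nu> snd. \<Psi> 0 x = x \<and> (\<forall>s\<in>{0..<T}.
      ((\<lambda>s. \<Psi> s x) has_vector_derivative - (\<integral>y. F (\<Psi> s x) (\<Psi> s y) \<partial>\<nu>)) (at s within {0..<T}))"
      using \<Psi> unfolding \<gamma>'(3) by (simp add: self_consistent_flow_def)
    note 2 = AE_distrD[OF fm(2) this]
    from 1 2 AE_space show ?thesis
    proof eventually_elim
      case (elim p)
      then show ?case
        unfolding good_def by (auto simp: space vel\<Phi> vel\<Psi> \<Phi>D \<Psi>D intro!: has_vector_derivative_diff)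
    qed
  qed
  have increment: "norm ((\<Phi> r (fst p) - \<Psi> r (snd p)) - (\<Phi> s (fst p) - \<Psi> s (snd p))) \<le> B * (r - s)"
    if p: "good p" and sr: "0 \<le> s" "s \<le> r" "r < T"
      and B: "\<And>q. s \<le> q \<Longrightarrow> q \<le> r \<Longrightarrow> norm (X q (\<Phi> q (fst p)) - Y q (\<Psi> q (snd p))) \<le> B" for p s r B
  proof (rule has_vector_derivative_increment_le[where f = "\<lambda>s. \<Phi> s (fst p) - \<Psi> s (snd p)", OF sr(2)])
    fix q assume "q \<in> {s..r}"
    then have "((\<lambda>s. \<Phi> s (fst p) - \<Psi> s (snd p)) has_vector_derivative
        X q (\<Phi> q (fst p)) - Y q (\<Psi> q (snd p))) (at q within {0..<T})"
      using p sr unfolding good_def by auto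
    then show "((\<lambda>s. \<Phi> s (fst p) - \<Psi> s (snd p)) has_vector_derivative
        X q (\<Phi> q (fst p)) - Y q (\<Psi> q (snd p))) (at q within {s..r})"
      by (rule has_vector_derivative_within_subset) (use sr in auto)
  qed (use B in auto)
  \<comment> \<open>Bounded speeds show that \<open>u\<close> and \<open>e\<close> move little between \<open>s\<close> and \<open>r\<close>.  This a priori bound
    replaces their values at intermediate times by those at \<open>s\<close> up to an error of order \<open>r - s\<close>,
    which becomes quadratic in the increment of \<open>u\<close>.\<close>
  have rough: "u r p \<le> u s p + 2 * C * (r - s)"
    if p: "good p" and sr: "0 \<le> s" "s \<le> r" "r < T" for p s r
  proof -
    have "norm (X q (\<Phi> q (fst p)) - Y q (\<Psi> q (snd p))) \<le> 2 * C" if "s \<le> q" "q \<le> r" for q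
    proof -
      have "norm (X q (\<Phi> q (fst p))) \<le> C" "norm (Y q (\<Psi> q (snd p))) \<le> C"
        using that sr p by (auto intro!: X_bound Y_bound \<Phi>D \<Psi>D simp: good_def mem_Times_iff)
      then show ?thesis using norm_triangle_ineq4[of "X q (\<Phi> q (fst p))" "Y q (\<Psi> q (snd p))"] by linarith
    qed
    from increment[OF p sr this] show ?thesis
      unfolding u_def using norm_triangle_sub[of "\<Phi> r (fst p) - \<Psi> r (snd p)" "\<Phi> s (fst p) - \<Psi> s (snd p)"]
      by linarith
  qed
  have e_rough: "e r \<le> e s + 2 * C * (r - s)" if sr: "0 \<le> s" "s \<le> r" "r < T" for s r
  proof -
    have "e r \<le> (\<integral>p. u s p + 2 * C * (r - s) \<partial>\<gamma>)"
      unfolding e_def using good u_int[of s] u_int[of r] sr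
      by (intro integral_mono_AE) (auto elim!: eventually_mono intro: rough)
    then show ?thesis using u_int[of s] sr by (simp add: e_def \<gamma>.prob_space)
  qed
  have fine: "u r p \<le> u s p + L * (u s p + e s + 4 * C * (r - s)) * (r - s)"
    if p: "good p" and sr: "0 \<le> s" "s \<le> r" "r < T" for p s r
  proof -
    have "norm (X q (\<Phi> q (fst p)) - Y q (\<Psi> q (snd p))) \<le> L * (u s p + e s + 4 * C * (r - s))"
      if q: "s \<le> q" "q \<le> r" for q
    proof -
      have "norm (X q (\<Phi> q (fst p)) - Y q (\<Psi> q (snd p))) \<le> L * (u q p + e q)"
        unfolding u_def using q sr p
        by (intro XY_diff) (auto intro!: \<Phi>D \<Psi>D simp: good_def mem_Times_iff)
      also have "u q p + e q \<le> u s p + e s + 4 * C * (q - s)"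
        using rough[OF p, of s q] e_rough[of s q] q sr by (simp add: algebra_simps)
      also have "\<dots> \<le> u s p + e s + 4 * C * (r - s)"
        using q C(1) by simp
      finally show ?thesis using L by (simp add: mult_left_mono)
    qed
    from increment[OF p sr this] show ?thesis
      unfolding u_def using norm_triangle_sub[of "\<Phi> r (fst p) - \<Psi> r (snd p)" "\<Phi> s (fst p) - \<Psi> s (snd p)"]
      by linarith
  qed
  have "e r \<le> (1 + 2 * L * (r - s)) * e s + 4 * L * C * (r - s)\<^sup>2" if sr: "0 \<le> s" "s \<le> r" "r < T" for s r
  proof -
    have "(\<integral>p. u r p \<partial>\<gamma>) \<le> (\<integral>p. u s p + L * (u s p + e s + 4 * C * (r - s)) * (r - s) \<partial>\<gamma>)"
      using good u_int[of s] u_int[of r] sr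
      by (intro integral_mono_AE) (auto elim!: eventually_mono intro: fine)
    also have "\<dots> = e s + L * (e s + e s + 4 * C * (r - s)) * (r - s)"
      using u_int[of s] sr by (simp add: e_def \<gamma>.prob_space)
    finally show ?thesis unfolding e_def by (simp add: algebra_simps power2_eq_square)
  qed
  then have "e t \<le> exp (2 * L * t) * e 0"
    using L C(1) t by (intro gronwall_quadratic_error[where B = "4 * L * C"]) (auto simp: e_def u_def)
  also have "e 0 = (\<integral>p. norm (fst p - snd p) \<partial>\<gamma>)"
    unfolding e_def
  proof (rule integral_cong_AE)
    have "fst \<in> borel_measurable \<gamma>" "snd \<in> borel_measurable \<gamma>"
      using fm by (simp_all add: measurable_restrict_space2_iff)
    then show "(\<lambda>p. norm (fst p - snd p)) \<in> borel_measurable \<gamma>" by measurable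
    show "AE p in \<gamma>. u 0 p = norm (fst p - snd p)"
      using good by eventually_elim (simp add: good_def u_def)
    show "u 0 \<in> borel_measurable \<gamma>" using u_int[of 0] t by simp
  qed
  finally show ?thesis by (simp add: e_def u_def)
qed

section \<open>Wasserstein estimate and convergence\<close>

lemma transport_plan_push_forward:
  assumes \<gamma>: "\<gamma> \<in> transport_plans \<mu> \<nu>" and sets: "sets \<mu> = sets M" "sets \<nu> = sets M"
    and f: "f \<in> M \<rightarrow>\<^sub>M M" and h: "h \<in> M \<rightarrow>\<^sub>M M"
  shows "distr \<gamma> (M \<Otimes>\<^sub>M M) (\<lambda>p. (f (fst p), h (snd p))) \<in> transport_plans (distr \<mu> M f) (distr \<nu> M h)"
    (is "?\<eta> \<in> _")
proof -
  have \<gamma>': "prob_space \<gamma>" "distr \<gamma> \<mu> fst = \<mu>" "distr \<gamma> \<nu> snd = \<nu>" "sets \<gamma> = sets (\<mu> \<Otimes>\<^sub>M \<nu>)"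
    using \<gamma> by (simp_all add: transport_plans_def)
  have s\<gamma>: "sets \<gamma> = sets (M \<Otimes>\<^sub>M M)" using \<gamma>'(4) sets_pair_measure_cong[OF sets] by simp
  have [measurable]: "fst \<in> \<gamma> \<rightarrow>\<^sub>M M" "snd \<in> \<gamma> \<rightarrow>\<^sub>M M"
    by (simp_all add: measurable_cong_sets[OF s\<gamma> refl])
  note [measurable] = f h
  have "(\<lambda>p. (f (fst p), h (snd p))) \<in> \<gamma> \<rightarrow>\<^sub>M M \<Otimes>\<^sub>M M" by measurable
  note g = this
  have fm: "f \<in> \<mu> \<rightarrow>\<^sub>M M" "h \<in> \<nu> \<rightarrow>\<^sub>M M" "fst \<in> \<gamma> \<rightarrow>\<^sub>M \<mu>" "snd \<in> \<gamma> \<rightarrow>\<^sub>M \<nu>"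
    using f h by (simp_all add: measurable_cong_sets[OF sets(1) refl] measurable_cong_sets[OF sets(2) refl]
        measurable_cong_sets[OF refl sets(1)] measurable_cong_sets[OF refl sets(2)])
  have "distr ?\<eta> M fst = distr (distr \<gamma> \<mu> fst) M f"
    using g fm by (simp add: distr_distr comp_def)
  moreover have "distr ?\<eta> M snd = distr (distr \<gamma> \<nu> snd) M h"
    using g fm by (simp add: distr_distr comp_def)
  \<comment> \<open>The target of \<open>distr\<close> matters only through its measurable sets.\<close>
  moreover have "distr ?\<eta> (distr \<mu> M f) fst = distr ?\<eta> M fst" "distr ?\<eta> (distr \<nu> M h) snd = distr ?\<eta> M snd"
    by (auto intro!: distr_cong)
  ultimately show ?thesis
    unfolding transport_plans_def using \<gamma>' g
    by (auto simp: prob_space.prob_space_distr intro!: sets_pair_measure_cong)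
qed

lemma borel_measurable_sphere_dist:
  fixes D :: "'a::euclidean_space set"
  assumes "D \<subseteq> sphere 0 1"
  shows "(\<lambda>p. sphere_dist (fst p) (snd p)) \<in> borel_measurable (restrict_space borel D \<Otimes>\<^sub>M restrict_space borel D)"
proof -
  let ?M = "restrict_space borel D :: 'a measure"
  have id: "(\<lambda>x. x) \<in> ?M \<rightarrow>\<^sub>M borel" by (simp add: measurable_restrict_space1)
  have "(\<lambda>p. fst p \<bullet> snd p) \<in> borel_measurable (?M \<Otimes>\<^sub>M ?M)"
    using measurable_compose[OF measurable_fst id] measurable_compose[OF measurable_snd id]
    by (rule borel_measurable_inner)
  moreover have "\<bar>x \<bullet> y\<bar> \<le> 1" if "x \<in> D" "y \<in> D" for x y
    using Cauchy_Schwarz_ineq2[of x y] subsetD[OF assms that(1)] subsetD[OF assms that(2)] by simp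
  then have "(\<lambda>p. fst p \<bullet> snd p) \<in> space (?M \<Otimes>\<^sub>M ?M) \<rightarrow> {-1..1}"
    by (fastforce simp: space_pair_measure space_restrict_space abs_le_iff)
  ultimately have "(\<lambda>p. fst p \<bullet> snd p) \<in> ?M \<Otimes>\<^sub>M ?M \<rightarrow>\<^sub>M restrict_space borel {-1..1}"
    by (simp add: measurable_restrict_space2_iff)
  from measurable_compose[OF this borel_measurable_continuous_on_restrict[OF continuous_on_arccos']]
  show ?thesis by (simp add: sphere_dist_def)
qed

lemma ennreal_mult_inverse_cancel:
  fixes c :: real and b :: ennreal
  assumes "0 < c"
  shows "ennreal (inverse c) * (ennreal c * b) = b" and "ennreal c * (ennreal (inverse c) * b) = b"
proof -
  have "ennreal (inverse c) * ennreal c = ennreal (inverse c * c)"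
    using assms by (intro ennreal_mult[symmetric]) auto
  also have "inverse c * c = 1" using assms by simp
  finally have 1: "ennreal (inverse c) * ennreal c = 1" by simp
  show "ennreal (inverse c) * (ennreal c * b) = b" by (simp only: mult.assoc[symmetric] 1 mult_1)
  show "ennreal c * (ennreal (inverse c) * b) = b"
    by (simp only: mult.assoc[symmetric] mult.commute[of "ennreal c"] 1 mult_1)
qed

text \<open>
  The intrinsic distance is at least the Euclidean one and at most \<open>C\<close> times it, so that the
  stability estimate for the Euclidean cost of each initial plan carries over to \<open>W1\<close>.
\<close>

lemma W1_self_consistent_flow_le:
  fixes D :: "'a::euclidean_space set"
  assumes D: "D \<subseteq> sphere 0 1"
    and C: "0 < C" "\<And>x y. x \<in> D \<Longrightarrow> y \<in> D \<Longrightarrow> sphere_dist x y \<le> C * norm (x - y)"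
    and F: "L-lipschitz_on (D \<times> D) (\<lambda>p. F (fst p) (snd p))"
    and \<mu>: "\<mu> \<in> prob_measures D" and \<nu>: "\<nu> \<in> prob_measures D"
    and \<Phi>: "self_consistent_flow F D T \<mu> \<Phi>" and \<Psi>: "self_consistent_flow F D T \<nu> \<Psi>"
    and t: "0 \<le> t" "t < T"
  shows "W1 (distr \<mu> (restrict_space borel D) (\<Phi> t)) (distr \<nu> (restrict_space borel D) (\<Psi> t))
    \<le> ennreal (C * exp (2 * L * t)) * W1 \<mu> \<nu>"
    (is "?W \<le> ennreal ?c * _")
proof -
  let ?M = "restrict_space borel D :: 'a measure"
  let ?d = "\<lambda>p. ennreal (sphere_dist (fst p) (snd p))"
  have c: "0 < ?c" using C(1) by simp
  have sets: "sets \<mu> = sets ?M" "sets \<nu> = sets ?M" using \<mu> \<nu> by (simp_all add: prob_measures_def)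
  have bdd: "bounded D" using bounded_subset[OF bounded_cball order_trans[OF D sphere_cball]] .
  have m: "\<Phi> t \<in> ?M \<rightarrow>\<^sub>M ?M" "\<Psi> t \<in> ?M \<rightarrow>\<^sub>M ?M"
    using \<Phi> \<Psi> t by (simp_all add: self_consistent_flow_def)
  have D_inv: "\<Phi> t x \<in> D" "\<Psi> t x \<in> D" if "x \<in> D" for x
    using measurable_space[OF m(1), of x] measurable_space[OF m(2), of x] that
    by (simp_all add: space_restrict_space)
  have "?W \<le> ennreal ?c * (\<integral>\<^sup>+p. ?d p \<partial>\<gamma>)" if \<gamma>: "\<gamma> \<in> transport_plans \<mu> \<nu>" for \<gamma>
  proof -
    interpret prob_space \<gamma> using \<gamma> by (simp add: transport_plans_def)
    have s\<gamma>: "sets \<gamma> = sets (?M \<Otimes>\<^sub>M ?M)"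
      using \<gamma> sets_pair_measure_cong[OF sets] by (simp add: transport_plans_def)
    have space: "space \<gamma> = D \<times> D"
      using sets_eq_imp_space_eq[OF s\<gamma>] by (simp add: space_pair_measure space_restrict_space)
    have fm: "fst \<in> \<gamma> \<rightarrow>\<^sub>M ?M" "snd \<in> \<gamma> \<rightarrow>\<^sub>M ?M"
      by (simp_all add: measurable_cong_sets[OF s\<gamma> refl])
    have g: "(\<lambda>p. (\<Phi> t (fst p), \<Psi> t (snd p))) \<in> \<gamma> \<rightarrow>\<^sub>M ?M \<Otimes>\<^sub>M ?M"
      using measurable_compose[OF fm(1) m(1)] measurable_compose[OF fm(2) m(2)] by (rule measurable_Pair)
    have int: "integrable \<gamma> (\<lambda>p. norm (f (fst p) - h (snd p)))"
      if f: "f \<in> ?M \<rightarrow>\<^sub>M ?M" and h: "h \<in> ?M \<rightarrow>\<^sub>M ?M" for f h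
    proof (rule integrable_const_bound[where B = 2])
      have b: "norm x \<le> 1" if "x \<in> D" for x using subsetD[OF D that] by simp
      have "norm (f x) \<le> 1" "norm (h x) \<le> 1" if "x \<in> D" for x
        using measurable_space[OF f, of x] measurable_space[OF h, of x] that
        by (auto simp: space_restrict_space intro: b)
      then have "norm (f x - h y) \<le> 1 + 1" if "x \<in> D" "y \<in> D" for x y
        using that by (intro norm_triangle_le_diff add_mono)
      then show "AE p in \<gamma>. norm (norm (f (fst p) - h (snd p))) \<le> 2"
        by (intro AE_I2) (simp add: space mem_Times_iff)
      have "(\<lambda>p. f (fst p)) \<in> borel_measurable \<gamma>" "(\<lambda>p. h (snd p)) \<in> borel_measurable \<gamma>"
        using measurable_compose[OF fm(1) f] measurable_compose[OF fm(2) h]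
        by (simp_all add: measurable_restrict_space2_iff)
      then show "(\<lambda>p. norm (f (fst p) - h (snd p))) \<in> borel_measurable \<gamma>" by measurable
    qed
    have "?W \<le> (\<integral>\<^sup>+p. ?d p \<partial>distr \<gamma> (?M \<Otimes>\<^sub>M ?M) (\<lambda>p. (\<Phi> t (fst p), \<Psi> t (snd p))))"
      unfolding W1_def by (rule INF_lower[OF transport_plan_push_forward[OF \<gamma> sets m]])
    also have "\<dots> = (\<integral>\<^sup>+p. ennreal (sphere_dist (\<Phi> t (fst p)) (\<Psi> t (snd p))) \<partial>\<gamma>)"
      by (subst nn_integral_distr[OF g])
        (simp_all add: measurable_compose[OF borel_measurable_sphere_dist[OF D] measurable_ennreal])
    also have "\<dots> \<le> (\<integral>\<^sup>+p. ennreal (C * norm (\<Phi> t (fst p) - \<Psi> t (snd p))) \<partial>\<gamma>)"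
      by (intro nn_integral_mono ennreal_leI C(2) D_inv) (auto simp: space)
    also have "\<dots> = ennreal (C * (\<integral>p. norm (\<Phi> t (fst p) - \<Psi> t (snd p)) \<partial>\<gamma>))"
      using int[OF m] C(1) by (subst nn_integral_eq_integral) auto
    also have "\<dots> \<le> ennreal (?c * (\<integral>p. norm (fst p - snd p) \<partial>\<gamma>))"
      using self_consistent_flow_stability[OF bdd F \<mu> \<nu> \<Phi> \<Psi> \<gamma> t] C(1)
      by (intro ennreal_leI) (simp add: mult.assoc)
    also have "\<dots> = ennreal ?c * (\<integral>\<^sup>+p. ennreal (norm (fst p - snd p)) \<partial>\<gamma>)"
      using int[OF measurable_ident measurable_ident] c
      by (subst nn_integral_eq_integral) (auto simp: ennreal_mult)
    also have "\<dots> \<le> ennreal ?c * (\<integral>\<^sup>+p. ?d p \<partial>\<gamma>)"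
      by (intro mult_left_mono nn_integral_mono ennreal_leI norm_diff_le_sphere_dist)
        (use D in \<open>auto simp: space\<close>)
    finally show ?thesis .
  qed
  moreover note cancel = ennreal_mult_inverse_cancel[OF c]
  \<comment> \<open>Dividing by \<open>?c\<close> leaves a lower bound that is independent of the plan, to be compared with the
    infimum.\<close>
  ultimately have "ennreal (inverse ?c) * ?W \<le> (\<integral>\<^sup>+p. ?d p \<partial>\<gamma>)" if "\<gamma> \<in> transport_plans \<mu> \<nu>" for \<gamma>
    using that cancel(1) mult_left_mono[of ?W "ennreal ?c * (\<integral>\<^sup>+p. ?d p \<partial>\<gamma>)" "ennreal (inverse ?c)"] by auto
  then have "ennreal (inverse ?c) * ?W \<le> W1 \<mu> \<nu>"
    unfolding W1_def[of \<mu> \<nu>] by (rule INF_greatest)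
  from mult_left_mono[OF this, of "ennreal ?c"] show ?thesis unfolding cancel by simp
qed

theorem theorem3p10:
  fixes \<epsilon> T :: real
    and K :: "(real ^ 'k) \<times> real \<Rightarrow> (real ^ 'k) \<times> real \<Rightarrow> real"
    and g g' :: "real \<Rightarrow> real"
    and \<rho>0 :: "((real ^ 'k) \<times> real) measure"
    and \<rho>0n :: "nat \<Rightarrow> ((real ^ 'k) \<times> real) measure"
    and \<rho> :: "real \<Rightarrow> ((real ^ 'k) \<times> real) measure"
    and \<rho>n :: "nat \<Rightarrow> real \<Rightarrow> ((real ^ 'k) \<times> real) measure"
  assumes "0 < \<epsilon>" and "\<epsilon> < pi / 2"
    and "\<And>x y. x \<in> sphere 0 1 \<Longrightarrow> y \<in> sphere 0 1 \<Longrightarrow> K x y = g ((sphere_dist x y)\<^sup>2)"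
    and "\<And>s. 0 \<le> s \<Longrightarrow> (g has_real_derivative g' s) (at s within {0..})"
    and "locally_lipschitz_on {0..} g'"
    and "\<rho>0 \<in> prob_measures (cap \<epsilon>)"
    and "\<And>n. 2 \<le> n \<Longrightarrow> empirical_measure (cap \<epsilon>) n (\<rho>0n n)"
    and "(\<lambda>n. W1 (\<rho>0n n) \<rho>0) \<longlonglongrightarrow> 0"
    and "0 < T"
    and "unique_weak_solution (cap \<epsilon>) K T \<rho>0 \<rho>"
    and "\<And>n. 2 \<le> n \<Longrightarrow> unique_weak_solution (cap \<epsilon>) K T (\<rho>0n n) (\<rho>n n)"
  shows "\<exists>T'. 0 < T' \<and> T' < T \<and>
    (\<lambda>n. SUP t\<in>{0..<T'}. W1 (\<rho>n n t) (\<rho> t)) \<longlonglongrightarrow> 0"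
proof -
  let ?D = "cap \<epsilon> :: ((real ^ 'k) \<times> real) set"
  let ?F = "kernel_grad g' :: (real ^ 'k) \<times> real \<Rightarrow> _ \<Rightarrow> _"
  define c0 where "c0 = 2 * (sin \<epsilon>)\<^sup>2 - 1"
  have c0: "-1 < c0" using sin_gt_zero[of \<epsilon>] assms(1,2) by (simp add: c0_def)
  have inner: "c0 \<le> x \<bullet> y" if "x \<in> ?D" "y \<in> ?D" for x y
    unfolding c0_def using inner_cap_ge[OF assms(1,2) that] .
  have unit: "norm x = 1" if "x \<in> ?D" for x using subsetD[OF cap_subset_sphere that] by simp
  obtain L where L: "L-lipschitz_on (?D \<times> ?D) (\<lambda>p. ?F (fst p) (snd p))"
    using lipschitz_on_kernel_grad[OF assms(5) c0 cap_subset_sphere inner] by blast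
  obtain C where C: "0 < C" "\<And>x y :: (real ^ 'k) \<times> real.
      norm x = 1 \<Longrightarrow> norm y = 1 \<Longrightarrow> c0 \<le> x \<bullet> y \<Longrightarrow> sphere_dist x y \<le> C * norm (x - y)"
    using sphere_dist_le_norm_diff[OF c0] by blast
  have grad: "sphere_grad (\<lambda>z. K z y) x = ?F x y" if "x \<in> ?D" "y \<in> ?D" for x y
  proof (rule sphere_grad_kernel[OF assms(4)])
    show "K z y = g ((sphere_dist z y)\<^sup>2)" if "norm z = 1" for z
      using that unit[OF \<open>y \<in> ?D\<close>] by (intro assms(3)) auto
    show "-1 < x \<bullet> y" using c0 inner[OF that] by linarith
  qed (use unit that in auto)
  have F_cont: "continuous_on ?D (?F x)" if "x \<in> ?D" for x
    using continuous_on_compose2[OF lipschitz_on_continuous_on[OF L], of ?D "\<lambda>y. (x, y)"] that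
    by (simp add: continuous_on_Pair image_subset_iff)
  obtain \<Psi> where \<Psi>: "self_consistent_flow ?F ?D T \<rho>0 \<Psi>"
    "\<And>t. t \<in> {0..<T} \<Longrightarrow> \<rho> t = distr \<rho>0 (restrict_space borel ?D) (\<Psi> t)"
    using weak_solution_imp_self_consistent_flow[OF _ assms(6) grad F_cont] assms(10)
    unfolding unique_weak_solution_def by blast
  define c where "c = C * exp (2 * L * T)"
  have bound: "(SUP t\<in>{0..<T / 2}. W1 (\<rho>n n t) (\<rho> t)) \<le> ennreal c * W1 (\<rho>0n n) \<rho>0" if n: "2 \<le> n" for n
  proof (rule SUP_least)
    fix t assume t: "t \<in> {0..<T / 2}"
    have prob: "\<rho>0n n \<in> prob_measures ?D" using assms(7)[OF n] by (simp add: empirical_measure_def)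
    obtain \<Phi> where \<Phi>: "self_consistent_flow ?F ?D T (\<rho>0n n) \<Phi>"
      "\<And>t. t \<in> {0..<T} \<Longrightarrow> \<rho>n n t = distr (\<rho>0n n) (restrict_space borel ?D) (\<Phi> t)"
      using weak_solution_imp_self_consistent_flow[OF _ prob grad F_cont] assms(11)[OF n]
      unfolding unique_weak_solution_def by blast
    have t': "0 \<le> t" "t < T" using t assms(9) by auto
    have "W1 (\<rho>n n t) (\<rho> t) \<le> ennreal (C * exp (2 * L * t)) * W1 (\<rho>0n n) \<rho>0"
      using W1_self_consistent_flow_le[OF cap_subset_sphere C(1) _ L prob assms(6) \<Phi>(1) \<Psi>(1) t']
        C(2) unit inner \<Phi>(2)[of t] \<Psi>(2)[of t] t' by simp
    also have "\<dots> \<le> ennreal c * W1 (\<rho>0n n) \<rho>0"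
      using C(1) lipschitz_on_nonneg[OF L] t' unfolding c_def
      by (intro mult_right_mono ennreal_leI mult_left_mono) (auto intro!: mult_left_mono)
    finally show "W1 (\<rho>n n t) (\<rho> t) \<le> ennreal c * W1 (\<rho>0n n) \<rho>0" .
  qed
  have "(\<lambda>n. ennreal c * W1 (\<rho>0n n) \<rho>0) \<longlonglongrightarrow> ennreal c * 0"
    using assms(8) by (intro tendsto_mult_ennreal tendsto_const) auto
  then have lim: "(\<lambda>n. ennreal c * W1 (\<rho>0n n) \<rho>0) \<longlonglongrightarrow> 0" by simp
  have "(\<lambda>n. SUP t\<in>{0..<T / 2}. W1 (\<rho>n n t) (\<rho> t)) \<longlonglongrightarrow> 0"
  proof (rule tendsto_sandwich[OF _ _ tendsto_const lim])
    show "\<forall>\<^sub>F n in sequentially.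
        (SUP t\<in>{0..<T / 2}. W1 (\<rho>n n t) (\<rho> t)) \<le> ennreal c * W1 (\<rho>0n n) \<rho>0"
      using bound by (rule eventually_sequentiallyI)
  qed simp
  then show ?thesis using assms(9) by (intro exI[of _ "T / 2"]) simp
qed

end
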